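(* In the setting described in the context (in particular under assumptions (A1)–(A7) and with exact data $y=G(\theta^\dagger)$), consider either the bi-level algorithm or the sequential bi-level algorithm, run with noise-free data $y$ and initial guess $\widetilde\theta^0\in B_R^X(\theta^\dagger)$. Let $0\le\sigma<\mu_R$, $0\le\nu<\sigma/2$, and let $\eta>0$ satisfy $(1+\eta)\widetilde M_R^2<M_R^2+\mu_R/2$. Assume that for each $j$ the lower-level iteration is terminated at a stopping index $\kappa(j)$, where the stopping indices are chosen so that the resulting state errors $\epsilon_j=\|u^j_{\kappa(j)}-S(\widetilde\theta^j)\|_{\mathcal U}$ satisfy, for all $j$, $$C_{\mathrm{pos}}\,\epsilon_j\le\|G(\widetilde\theta^j)-y\|_{\mathcal Y},\qquad C_{\mathrm{pos}}:=\sqrt{\frac{C_{\mathrm{pri}}}{\sigma/2-\nu}},$$ where $$C_{\mathrm{pri}}:=\|L\|^2\left(\frac{2\,(K_R+C_{\nabla f,A}R)^2}{\mu_R-\sigma}+\Big(1+\frac1\eta\Big)\widetilde M_R^2+2C_{\nabla f,A}R\right).$$ Then both of the following hold: (i) the approximate parameter sequence $\{\widetilde\theta^j\}_j$ remains within the ball $B_R^X(\theta^\dagger)$; (ii) $\{\widetilde\theta^j\}_j$ converges strongly in $X$ to a solution of the inverse problem, and the full image sequence also converges strongly, i.e. $\widetilde\theta^j\to\bar\theta$ and $G(\widetilde\theta^j)\to y$ as $j\to\infty$, with $G(\bar\theta)=y$.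
   Context: Spaces and operators. $U\hookrightarrow H\hookrightarrow U^*$ is a Gelfand triple with $U$ a Hilbert space, $T>0$, $\mathcal U=L^2(0,T;U)$, $\mathcal U^*=L^2(0,T;U^* )$, $\mathcal V=\{u\in\mathcal U:\dot u\in\mathcal U^*\}$ (so $\mathcal V\hookrightarrow C(0,T;H)$). $X$ (parameter space) and $\mathcal Y$ (observation space) are Hilbert spaces, $A:X\to H$ and $L:\mathcal U\to\mathcal Y$ are bounded linear. $f:(0,T)\times X\times U\to U^*$ is a nonlinear Carathéodory map inducing $f:X\times\mathcal V\to\mathcal U^*$, $[f(\theta,u)](t)=f(t,\theta,u(t))$, with partial derivatives $f'_\theta,f'_u$. $S:X\to\mathcal V$ is the parameter-to-state map: $u=S(\theta)$ solves $\dot u+f(\theta,u)=0$ on $(0,T)$, $u(0)=A\theta$ (assumed solvable); $S$ is Fréchet differentiable. $G=L\circ S$; the inverse problem is to solve $G(\theta)=y$. Set $F(\theta,u)={}_\theta\mathbf F(u)=(\dot u+f(\theta,u),\,u|_{t=0}-A\theta)\in\mathcal U^*\times H$, so that $u=S(\theta)$ solves $F(\theta,u)=\varphi$ (with $\varphi=0$). $D_U:U\to U^*$ and $I_X:X^*\to X$ are isomorphisms; $^\star$ is the Banach space adjoint, $^*$ on operators between Hilbert spaces is the Hilbert space adjoint. $\theta^\dagger$ is the exact parameter, $u^\dagger=S(\theta^\dagger)$ the exact state, $y=G(\theta^\dagger)$; $B_R^X(\theta^\dagger)\subset X$ and $B_r^{\mathcal V}(u^\dagger)\subset\mathcal V$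 are the balls of radius $R$, $r$ around $\theta^\dagger$, $u^\dagger$. Algorithms (noise-free data $y$). Upper level: $\widetilde\theta^{j+1}=\widetilde\theta^j-\widetilde{S'}(\widetilde\theta^j)^*L^*\big(L\widetilde S_{\kappa(j)}(\widetilde\theta^j)-y\big)$, $j=0,1,\dots$. Lower level: for each $j$, starting from $u^j_0$, $u^j_{k+1}=u^j_k-F'_u(\widetilde\theta^j,u^j_k)^*\big(F(\widetilde\theta^j,u^j_k)-\varphi\big)$ until $k=\kappa(j)$, and $\widetilde S_{\kappa(j)}(\widetilde\theta^j):=u^j_{\kappa(j)}$. In the bi-level algorithm $u^j_0$ is arbitrary in $B^{\mathcal V}_{r/2}(u^j_* )$, where $u^j_*:=S(\widetilde\theta^j)$; in the sequential bi-level algorithm $u^j_0:=u^{j-1}_{\kappa(j-1)}$ for $j\ge1$, and it is assumed that $u^j_0\in B^{\mathcal V}_{r/2}(u^j_* )$ for all $j$. The states $u^j_*$ and the lower-level iterates $u^j_k$ lie in $B_r^{\mathcal V}(u^\dagger)$ as long as $\widetilde\theta^j\in B_R^X(\theta^\dagger)$. The approximate adjoint is, for $v\in\mathcal U$, $$\widetilde{S'}(\widetilde\theta^j)^*v=-\int_0^T I_Xf'_\theta(\widetilde\theta^j,u^j_{\kappa(j)})(t)^\star\tilde z(t)\,dt+I_XA^\star\tilde z(0),$$ where $-\dot{\tilde z}+f'_u(\widetilde\theta^j,u^j_{\kappa(j)})^\star\tilde z=D_Uv$ on $(0,T)$, $\tilde z(T)=0$ (the exact adjoint $S'(\theta)^*v$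 has the same form with $S(\theta)$ in place of $u^j_{\kappa(j)}$). Assumptions: for all $\theta,\hat\theta\in B_R^X(\theta^\dagger)$, $u,\hat u\in B_r^{\mathcal V}(u^\dagger)$, with positive constants $\overline M_S,M_S,C_{f_u},L_{\nabla f},C_{coe},M_r,\mu_r,M_R,\mu_R,K_R$, where $M_r^2+\mu_r<2$, $M_R^2+\mu_R<2$: (A1) $\|S'(\theta)\|_{X\to\mathcal V}\le\overline M_S$, $\|S'(\theta)\|_{X\to\mathcal U}\le M_S$, $\|G'(\theta)\|_{X\to\mathcal Y}\le M_R$. (A2) The solution of the adjoint equation $-\dot z+f'_u(\theta,u)^\star z=h$, $z(T)=0$ satisfies $\|z\|_{\mathcal U}+\|z(0)\|_H\le C_{f_u}\|h\|_{\mathcal U^*}$. (A3) $\|f'_\theta(\theta,u)-f'_\theta(\hat\theta,\hat u)\|_{X\to\mathcal U^*}+\|f'_u(\theta,u)-f'_u(\hat\theta,\hat u)\|_{\mathcal U\to\mathcal U^*}\le L_{\nabla f}(\|\theta-\hat\theta\|_X+\|u-\hat u\|_{\mathcal U})$. (A4) $\|{}_\theta\mathbf F'(u)\|_{\mathcal V\to\mathcal U^*\times H}\le M_r$. (A5) $2\big({}_\theta\mathbf F(u)-{}_\theta\mathbf F(\hat u),{}_\theta\mathbf F'(u)(u-\hat u)\big)_{\mathcal U^*\times H}\ge(M_r^2+\mu_r)\|{}_\theta\mathbf F(u)-{}_\theta\mathbf F(\hat u)\|^2_{\mathcal U^*\times H}$. (A6) For some $\alpha\ge1$: $C_{coe}\|{}_\theta\mathbf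 F(u)-{}_\theta\mathbf F(u_* )\|_{\mathcal U^*\times H}\ge\|u-u_*\|_{\mathcal V}^\alpha$, $u_*=S(\theta)$. (A7) $2\big(G(\theta)-G(\hat\theta),G'(\theta)(\theta-\hat\theta)\big)_{\mathcal Y}\ge(M_R^2+\mu_R)\|G(\theta)-G(\hat\theta)\|^2_{\mathcal Y}$ and $\|G'(\theta)(\theta-\hat\theta)\|_{\mathcal Y}\le K_R\|G(\theta)-G(\hat\theta)\|_{\mathcal Y}$. Constants. $L_{R,r}:=L_{\nabla f}(R+rC_{\mathcal V\to\mathcal U})+\|f'_\theta(\theta^\dagger,u^\dagger)\|_{X\to\mathcal U^*}+\|f'_u(\theta^\dagger,u^\dagger)\|_{\mathcal U\to\mathcal U^*}$ with $C_{\mathcal V\to\mathcal U}$ the embedding norm; $C_{\nabla f,A}:=L_{\nabla f}C_{f_u}\|I_X\|\|D_U\|\,[L_{R,r}C_{f_u}+1+\|A\|C_{f_u}]$; $\bar\epsilon$ is an upper bound of all $\epsilon_j$; $\widetilde M_R:=(M_S+C_{\nabla f,A}\bar\epsilon)\|L\|$. *)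

theory Defs
  imports "HOL-Analysis.Analysis"
begin

type_synonym 'a dual = "'a \<Rightarrow>\<^sub>L real"

definition time_measure :: "real \<Rightarrow> real measure" where
  "time_measure T = lebesgue_on {0<..<T}"

text \<open>Bochner measurability, without separability of the target space. It is used with the complete
  measure \<open>time_measure T\<close>, so the exceptional null set does no harm.\<close>

definition strongly_measurable :: "'m measure \<Rightarrow> ('m \<Rightarrow> 'a::topological_space) \<Rightarrow> bool" where
  "strongly_measurable M g \<longleftrightarrow>
     (\<exists>s. (\<forall>i::nat. simple_function M (s i)) \<and> (AE t in M. (\<lambda>i. s i t) \<longlonglongrightarrow> g t))"

definition L2 :: "real \<Rightarrow> (real \<Rightarrow> 'a::real_normed_vector) set" where
  "L2 T = {g. strongly_measurable (time_measure T) g \<and>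
              integrable (time_measure T) (\<lambda>t. (norm (g t))\<^sup>2)}"

text \<open>
  Types cannot depend on the real number T, so the Hilbert space of a.e.-equivalence classes of
  square integrable functions on (0,T) is given as a type \<open>'s\<close> together with a map \<open>\<rho>\<close> that
  selects a representative of each class: \<open>L2_space T \<rho>\<close> says that \<open>\<rho>\<close> induces an isometric
  isomorphism of \<open>'s\<close> onto the space of all such classes. If \<open>'s\<close> is an inner product space,
  then its inner product is determined by the norm (polarization). In this way the dual
  \<open>'u dual\<close> of a Hilbert space, which carries no \<open>real_inner\<close> instance, can be used as target.
\<close>

definition L2_space :: "real \<Rightarrow> ('s::real_normed_vector \<Rightarrow> real \<Rightarrow> 'a::real_normed_vector) \<Rightarrow> bool" where
  "L2_space T \<rho> \<longleftrightarrow>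
     (\<forall>v. \<rho> v \<in> L2 T) \<and>
     (\<forall>v w. AE t in time_measure T. \<rho> (v + w) t = \<rho> v t + \<rho> w t) \<and>
     (\<forall>c v. AE t in time_measure T. \<rho> (c *\<^sub>R v) t = c *\<^sub>R \<rho> v t) \<and>
     (\<forall>v. norm v = sqrt (\<integral>t. (norm (\<rho> v t))\<^sup>2 \<partial>time_measure T)) \<and>
     (\<forall>g\<in>L2 T. \<exists>v. AE t in time_measure T. \<rho> v t = g t)"

definition gelfand_triple :: "('u::{real_inner,complete_space} \<Rightarrow>\<^sub>L 'h::{real_inner,complete_space}) \<Rightarrow> bool" where
  "gelfand_triple \<iota> \<longleftrightarrow> inj (blinfun_apply \<iota>) \<and> closure (range (blinfun_apply \<iota>)) = UNIV"

definition test_function :: "real \<Rightarrow> (real \<Rightarrow> real) \<Rightarrow> bool" where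
  "test_function T \<phi> \<longleftrightarrow>
     (\<forall>n x. (deriv ^^ n) \<phi> field_differentiable at x) \<and>
     (\<exists>a b. 0 < a \<and> b < T \<and> (\<forall>x. x \<notin> {a..b} \<longrightarrow> \<phi> x = 0))"

text \<open>\<open>w\<close> is the distributional time derivative of \<open>u\<close> with values in the dual of \<open>'u\<close>; an element
  \<open>x\<close> of the pivot space acts on \<open>'u\<close> by \<open>\<lambda>e. x \<bullet> \<iota> e\<close>.\<close>

definition weak_derivative ::
  "real \<Rightarrow> ('u::real_inner \<Rightarrow>\<^sub>L 'h::real_inner) \<Rightarrow> (real \<Rightarrow> 'u) \<Rightarrow> (real \<Rightarrow> 'u dual) \<Rightarrow> bool" where
  "weak_derivative T \<iota> u w \<longleftrightarrow>
     (\<forall>\<phi> e. test_function T \<phi> \<longrightarrow>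
        (\<integral>t. deriv \<phi> t * (\<iota> (u t) \<bullet> \<iota> e) \<partial>time_measure T) =
        - (\<integral>t. \<phi> t * w t e \<partial>time_measure T))"

text \<open>\<open>'v\<close> is the space of all \<open>u\<close> in \<open>'l\<close> (the functions with values in \<open>'u\<close>) whose time derivative
  lies in \<open>'d\<close> (the functions with values in the dual), with the graph inner product. \<open>J\<close> is the
  embedding of \<open>'v\<close> into \<open>'l\<close> and \<open>D\<^sub>t\<close> is the time derivative.\<close>

definition W_space ::
  "real \<Rightarrow> ('u::real_inner \<Rightarrow>\<^sub>L 'h::real_inner) \<Rightarrow> ('l::real_inner \<Rightarrow> real \<Rightarrow> 'u) \<Rightarrow>
   ('d::real_inner \<Rightarrow> real \<Rightarrow> 'u dual) \<Rightarrow> ('v::real_inner \<Rightarrow>\<^sub>L 'l) \<Rightarrow> ('v \<Rightarrow>\<^sub>L 'd) \<Rightarrow> bool" where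
  "W_space T \<iota> \<rho> \<rho>' J D\<^sub>t \<longleftrightarrow>
     (\<forall>g w. weak_derivative T \<iota> (\<rho> g) (\<rho>' w) \<longleftrightarrow> (\<exists>v. J v = g \<and> D\<^sub>t v = w)) \<and>
     (\<forall>v. (norm v)\<^sup>2 = (norm (J v))\<^sup>2 + (norm (D\<^sub>t v))\<^sup>2)"

text \<open>Point values are those of the continuous representative with values in the pivot space.\<close>

definition has_trace ::
  "real \<Rightarrow> ('u::real_inner \<Rightarrow>\<^sub>L 'h::real_inner) \<Rightarrow> (real \<Rightarrow> 'u) \<Rightarrow> real \<Rightarrow> 'h \<Rightarrow> bool" where
  "has_trace T \<iota> u s x \<longleftrightarrow>
     (\<exists>c. continuous_on {0..T} c \<and> (AE t in time_measure T. c t = \<iota> (u t)) \<and> c s = x)"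

definition time_trace ::
  "real \<Rightarrow> ('u::real_inner \<Rightarrow>\<^sub>L 'h::real_inner) \<Rightarrow> (real \<Rightarrow> 'u) \<Rightarrow> real \<Rightarrow> 'h" where
  "time_trace T \<iota> u s = (THE x. has_trace T \<iota> u s x)"

definition pairing :: "real \<Rightarrow> (real \<Rightarrow> 'u::real_normed_vector dual) \<Rightarrow> (real \<Rightarrow> 'u) \<Rightarrow> real" where
  "pairing T g w = (\<integral>t. g t (w t) \<partial>time_measure T)"

text \<open>Gelfand-Pettis integral over (0,T). It equals the Bochner integral whenever the latter
  exists, but it does not need separability of \<open>'x\<close> or integrability of the norm.\<close>

definition weak_integral :: "real \<Rightarrow> (real \<Rightarrow> 'x::real_inner) \<Rightarrow> 'x" where
  "weak_integral T g = (THE w. \<forall>h. w \<bullet> h = (\<integral>t. g t \<bullet> h \<partial>time_measure T))"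

definition banach_adjoint ::
  "('a::real_normed_vector \<Rightarrow>\<^sub>L 'b::real_normed_vector) \<Rightarrow> 'b dual \<Rightarrow> 'a dual" where
  "banach_adjoint B \<phi> = \<phi> o\<^sub>L B"

definition bidual :: "'u::real_normed_vector \<Rightarrow> 'u dual dual" where
  "bidual e = Blinfun (\<lambda>g. blinfun_apply g e)"

definition caratheodory ::
  "real \<Rightarrow> (real \<Rightarrow> 'x::topological_space \<Rightarrow> 'u::real_normed_vector \<Rightarrow> 'u dual) \<Rightarrow> bool" where
  "caratheodory T f \<longleftrightarrow>
     (\<forall>\<theta> e. strongly_measurable (time_measure T) (\<lambda>t. f t \<theta> e)) \<and>
     (AE t in time_measure T. continuous_on UNIV (\<lambda>(\<theta>, e). f t \<theta> e))"

text \<open>The map \<open>(\<theta>, u) \<mapsto> (u' + f(\<theta>, u), u(0) - A \<theta>)\<close>; \<open>fN\<close> is the map induced by \<open>f\<close>.\<close>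

definition residual_map ::
  "real \<Rightarrow> ('u::real_inner \<Rightarrow>\<^sub>L 'h::real_inner) \<Rightarrow> ('l::real_inner \<Rightarrow> real \<Rightarrow> 'u) \<Rightarrow>
   ('v::real_inner \<Rightarrow>\<^sub>L 'l) \<Rightarrow> ('v \<Rightarrow>\<^sub>L 'd::real_inner) \<Rightarrow> ('x::real_inner \<Rightarrow>\<^sub>L 'h) \<Rightarrow>
   ('x \<Rightarrow> 'v \<Rightarrow> 'd) \<Rightarrow> 'x \<Rightarrow> 'v \<Rightarrow> 'd \<times> 'h" where
  "residual_map T \<iota> \<rho> J D\<^sub>t A fN \<theta> u = (D\<^sub>t u + fN \<theta> u, time_trace T \<iota> (\<rho> (J u)) 0 - A \<theta>)"

text \<open>\<open>- z' + B\<^sup>\<star> z = h\<close> on (0,T), \<open>z(T) = 0\<close>. The witness \<open>b\<close> is \<open>B\<^sup>\<star> z\<close>, where the bidual of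
  \<open>'l\<close> is identified with \<open>'l\<close> and its dual with \<open>'d\<close> through \<open>pairing\<close>.\<close>

definition adjoint_solution ::
  "real \<Rightarrow> ('u::real_inner \<Rightarrow>\<^sub>L 'h::real_inner) \<Rightarrow> ('l::real_inner \<Rightarrow> real \<Rightarrow> 'u) \<Rightarrow>
   ('d::real_inner \<Rightarrow> real \<Rightarrow> 'u dual) \<Rightarrow> ('v::real_inner \<Rightarrow>\<^sub>L 'l) \<Rightarrow> ('v \<Rightarrow>\<^sub>L 'd) \<Rightarrow>
   ('l \<Rightarrow>\<^sub>L 'd) \<Rightarrow> 'd \<Rightarrow> 'v \<Rightarrow> bool" where
  "adjoint_solution T \<iota> \<rho> \<rho>' J D\<^sub>t B h z \<longleftrightarrow>
     (\<exists>b. (\<forall>w. pairing T (\<rho>' b) (\<rho> w) = pairing T (\<rho>' (B w)) (\<rho> (J z))) \<and> - D\<^sub>t z + b = h) \<and>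
     has_trace T \<iota> (\<rho> (J z)) T 0"

text \<open>
  \<open>v \<mapsto> - \<integral>\<^sub>0\<^sup>T I\<^sub>X k(t)\<^sup>\<star> z(t) dt + I\<^sub>X A\<^sup>\<star> z(0)\<close> where \<open>- z' + B\<^sup>\<star> z = D\<^sub>U v\<close>, \<open>z(T) = 0\<close>.
  Evaluated with the derivatives \<open>k\<close>, \<open>B\<close> of \<open>f\<close> with respect to \<open>\<theta>\<close> and \<open>u\<close> at an approximate
  state it gives the approximate adjoint, at the exact state the exact one.
\<close>

definition adjoint_formula ::
  "real \<Rightarrow> ('u::real_inner \<Rightarrow>\<^sub>L 'h::real_inner) \<Rightarrow> ('l::real_inner \<Rightarrow> real \<Rightarrow> 'u) \<Rightarrow>
   ('d::real_inner \<Rightarrow> real \<Rightarrow> 'u dual) \<Rightarrow> ('v::real_inner \<Rightarrow>\<^sub>L 'l) \<Rightarrow> ('v \<Rightarrow>\<^sub>L 'd) \<Rightarrow>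
   ('x::real_inner \<Rightarrow>\<^sub>L 'h) \<Rightarrow> ('x dual \<Rightarrow>\<^sub>L 'x) \<Rightarrow> ('u \<Rightarrow>\<^sub>L 'u dual) \<Rightarrow>
   (real \<Rightarrow> 'x \<Rightarrow>\<^sub>L 'u dual) \<Rightarrow> ('l \<Rightarrow>\<^sub>L 'd) \<Rightarrow> 'l \<Rightarrow> 'x" where
  "adjoint_formula T \<iota> \<rho> \<rho>' J D\<^sub>t A I\<^sub>X D\<^sub>U k B v =
     (let z = (THE z. \<exists>h. (AE t in time_measure T. \<rho>' h t = D\<^sub>U (\<rho> v t)) \<and>
                          adjoint_solution T \<iota> \<rho> \<rho>' J D\<^sub>t B h z)
      in - weak_integral T (\<lambda>t. I\<^sub>X (banach_adjoint (k t) (bidual (\<rho> (J z) t)))) +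
         I\<^sub>X (banach_adjoint A (blinfun_inner_right (time_trace T \<iota> (\<rho> (J z)) 0))))"

text \<open>\<open>u j k\<close> is the k-th lower-level iterate in the j-th upper-level step and \<open>\<kappa> j\<close> the stopping
  index; \<open>Sadj \<theta> u\<close> is the approximate adjoint at the parameter \<open>\<theta>\<close> and the state \<open>u\<close>.\<close>

definition upper_level ::
  "('x::real_inner \<Rightarrow> 'v::real_inner \<Rightarrow> 'l::real_inner \<Rightarrow> 'x) \<Rightarrow> ('v \<Rightarrow>\<^sub>L 'l) \<Rightarrow>
   ('l \<Rightarrow>\<^sub>L 'y::real_inner) \<Rightarrow> 'y \<Rightarrow> (nat \<Rightarrow> 'x) \<Rightarrow> (nat \<Rightarrow> nat \<Rightarrow> 'v) \<Rightarrow> (nat \<Rightarrow> nat) \<Rightarrow> bool" where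
  "upper_level Sadj J L y \<theta> u \<kappa> \<longleftrightarrow>
     (\<forall>j. \<theta> (Suc j) =
        \<theta> j - Sadj (\<theta> j) (u j (\<kappa> j)) (adjoint (blinfun_apply L) (L (J (u j (\<kappa> j))) - y)))"

definition lower_level ::
  "('x::real_inner \<Rightarrow> 'v::real_inner \<Rightarrow> 'w::real_inner) \<Rightarrow> 'w \<Rightarrow>
   (nat \<Rightarrow> 'x) \<Rightarrow> (nat \<Rightarrow> nat \<Rightarrow> 'v) \<Rightarrow> (nat \<Rightarrow> nat) \<Rightarrow> bool" where
  "lower_level F \<phi> \<theta> u \<kappa> \<longleftrightarrow>
     (\<forall>j. \<forall>k<\<kappa> j. u j (Suc k) =
        u j k - adjoint (frechet_derivative (F (\<theta> j)) (at (u j k))) (F (\<theta> j) (u j k) - \<phi>))"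

definition bilevel_algorithm where
  "bilevel_algorithm Sadj J L y F \<phi> S r \<theta> u \<kappa> \<longleftrightarrow>
     upper_level Sadj J L y \<theta> u \<kappa> \<and> lower_level F \<phi> \<theta> u \<kappa> \<and>
     (\<forall>j. u j 0 \<in> ball (S (\<theta> j)) (r / 2))"

definition sequential_bilevel_algorithm where
  "sequential_bilevel_algorithm Sadj J L y F \<phi> S r \<theta> u \<kappa> \<longleftrightarrow>
     upper_level Sadj J L y \<theta> u \<kappa> \<and> lower_level F \<phi> \<theta> u \<kappa> \<and>
     (\<forall>j. u (Suc j) 0 = u j (\<kappa> j)) \<and>
     (\<forall>j. u j 0 \<in> ball (S (\<theta> j)) (r / 2))"

end

theory Submission
  imports Defs
begin

text \<open>
  The upper-level iteration is a Landweber iteration for \<open>G \<theta> = y\<close> in which each step is perturbed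
  twice: the residual is evaluated at the lower-level state instead of \<open>S (\<theta> j)\<close>, and the adjoint is
  linearized there. Both perturbations are proportional to \<open>norm L * \<epsilon> j\<close>, with \<open>\<epsilon> j\<close> the state error,
  and the stopping rule bounds this quantity by a multiple of the residual \<open>G (\<theta> j) - y\<close>. The
  bi-level and the sequential bi-level algorithm share this upper level.

  The first ingredient is that the approximate adjoint deviates from the exact one by at most
  \<open>CfA * \<epsilon> j\<close> in norm (\<open>adjoint_formula_perturbation\<close>). The adjoint states for two linearizations
  differ by a solution of the adjoint equation whose right-hand side is the difference of the two
  operators applied to one of the states (\<open>solves_adjoint_diff\<close>), and the assumed stability of the
  adjoint equation bounds it. Behind this is the duality between square integrable functions with
  values in \<open>'u\<close> and in its dual, which yields adjoints of operators (\<open>operator_adjoint\<close>) and the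
  existence of the weak integral in the adjoint formula (\<open>weak_integral_adjoint\<close>).

  The second ingredient is the analysis of inexact Landweber steps in the locale
  \<open>inexact_landweber\<close>. The monotonicity condition on \<open>G\<close> has a surplus \<open>\<mu>R\<close> over what a pure descent
  argument needs; the surplus absorbs all perturbations, and a positive multiple of the squared
  residual remains (\<open>squared_error_decrease\<close>). Hence the error to the exact parameter never
  increases, which keeps the iterates in the ball, and the squared residuals are summable, which
  gives convergence of the images. Strong convergence of the iterates themselves is obtained by
  comparing two of them with the one of smallest residual in between (\<open>Cauchy_iterates\<close>); the
  tangential cone condition bounds the inner products that occur there by summable terms. By
  continuity of \<open>G\<close> the limit solves the inverse problem.
\<close>

section \<open>Bounded functionals and adjoints in Hilbert spaces\<close>

text \<open>
  A representer of \<open>f\<close> is a minimizer of \<open>\<parallel>x\<parallel>\<^sup>2 - 2 f x\<close>. The parallelogram law bounds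
  \<open>\<parallel>a - b\<parallel>\<^sup>2\<close> by how far the two values at \<open>a\<close> and \<open>b\<close> exceed the infimum, so minimizing
  sequences are Cauchy and a minimizer exists; at the minimizer the derivative vanishes in every
  direction.
\<close>

lemma riesz_representation:
  fixes f :: "'a::{real_inner,complete_space} \<Rightarrow> real"
  assumes f: "bounded_linear f"
  obtains w where "\<And>h. f h = w \<bullet> h"
proof -
  interpret f: bounded_linear f by fact
  define \<phi> where "\<phi> x = (norm x)\<^sup>2 - 2 * f x" for x
  define m where "m = Inf (range \<phi>)"
  obtain K where K: "\<bar>f x\<bar> \<le> norm x * K" for x
    using f.bounded by auto
  have "- K\<^sup>2 \<le> \<phi> x" for x
  proof -
    have "0 \<le> (norm x - K)\<^sup>2" by simp
    then show ?thesis
      using K[of x] unfolding \<phi>_def by (simp add: power2_diff)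
  qed
  then have bdd: "bdd_below (range \<phi>)"
    by (auto simp: bdd_below_def)
  have m_le: "m \<le> \<phi> x" for x
    unfolding m_def by (rule cInf_lower[OF _ bdd]) simp
  have "\<exists>x. \<phi> x < m + 1 / Suc n" for n
    using cInf_lessD[of "range \<phi>" "m + 1 / Suc n"] unfolding m_def by auto
  then obtain x where x: "\<phi> (x n) < m + 1 / Suc n" for n by metis
  have parallelogram: "(norm (a - b))\<^sup>2 \<le> 2 * (\<phi> a - m) + 2 * (\<phi> b - m)" for a b
  proof -
    have "4 * \<phi> ((1/2) *\<^sub>R (a + b)) = (norm (a + b))\<^sup>2 - 4 * f a - 4 * f b"
      unfolding \<phi>_def
      by (simp only: f.scaleR f.add norm_scaleR power_mult_distrib) (simp add: power2_eq_square field_simps)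
    moreover have "(norm (a - b))\<^sup>2 + (norm (a + b))\<^sup>2 = 2 * (norm a)\<^sup>2 + 2 * (norm b)\<^sup>2"
      by (simp add: power2_norm_eq_inner inner_simps inner_commute)
    moreover have "\<phi> a = (norm a)\<^sup>2 - 2 * f a" "\<phi> b = (norm b)\<^sup>2 - 2 * f b"
      by (simp_all add: \<phi>_def)
    ultimately show ?thesis
      using m_le[of "(1/2) *\<^sub>R (a + b)"] by argo
  qed
  have "Cauchy x"
  proof (rule metric_CauchyI)
    fix e :: real assume e: "0 < e"
    obtain N where N: "4 / e\<^sup>2 < real (Suc N)"
      using reals_Archimedean2 by (metis less_Suc_eq of_nat_less_iff order.strict_trans)
    have small: "\<phi> (x n) - m < e\<^sup>2 / 4" if "N \<le> n" for n
    proof -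
      have "4 / e\<^sup>2 < real (Suc n)" using N that by simp
      then have "1 / real (Suc n) < e\<^sup>2 / 4"
        using e by (simp add: field_simps)
      then show ?thesis using x[of n] by linarith
    qed
    have "dist (x i) (x n) < e" if "N \<le> i" "N \<le> n" for i n
    proof -
      have "(norm (x i - x n))\<^sup>2 < e\<^sup>2"
        using parallelogram[of "x i" "x n"] small[OF that(1)] small[OF that(2)] by argo
      then show ?thesis
        using e by (simp add: dist_norm power2_less_imp_less)
    qed
    then show "\<exists>M. \<forall>i\<ge>M. \<forall>n\<ge>M. dist (x i) (x n) < e" by blast
  qed
  then obtain w where w: "x \<longlonglongrightarrow> w"
    using Cauchy_convergent convergent_def by blast
  have "(\<lambda>n. \<phi> (x n)) \<longlonglongrightarrow> \<phi> w"
    unfolding \<phi>_def by (intro tendsto_intros w f.tendsto)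
  moreover have "(\<lambda>n. m + 1 / real (Suc n)) \<longlonglongrightarrow> m + 0"
    using LIMSEQ_inverse_real_of_nat by (intro tendsto_intros) (simp add: inverse_eq_divide)
  ultimately have "\<phi> w \<le> m"
    using x by (intro LIMSEQ_le[of "\<lambda>n. \<phi> (x n)" _ "\<lambda>n. m + 1 / real (Suc n)"]) (auto intro: less_imp_le)
  have "f h = w \<bullet> h" for h
  proof (rule ccontr)
    assume neq: "f h \<noteq> w \<bullet> h"
    define d where "d = f h - w \<bullet> h"
    have h: "0 < (norm h)\<^sup>2"
      using neq f.zero by auto
    \<comment> \<open>the step length along \<open>h\<close> that decreases \<open>\<phi>\<close> most\<close>
    define t where "t = d / (norm h)\<^sup>2"
    have d: "0 < d\<^sup>2 / (norm h)\<^sup>2"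
      using h neq by (simp add: d_def)
    have "\<phi> (w + t *\<^sub>R h) = \<phi> w + t * t * (norm h)\<^sup>2 - 2 * t * d"
      unfolding \<phi>_def d_def
      by (simp add: f.scaleR f.add power2_norm_eq_inner inner_simps inner_commute algebra_simps)
    also have "\<dots> = \<phi> w - d\<^sup>2 / (norm h)\<^sup>2"
      using h by (simp add: t_def power2_eq_square field_simps)
    also have "\<dots> < \<phi> w"
      using d by linarith
    finally show False
      using m_le[of "w + t *\<^sub>R h"] \<open>\<phi> w \<le> m\<close> by linarith
  qed
  then show thesis by (rule that)
qed

text \<open>
  The operator \<open>adjoint\<close> is defined by Hilbert choice, so it has its defining property as soon as
  some adjoint exists. In a Hilbert space this is the representation theorem, without a restriction
  to finite dimension.
\<close>

lemma inner_adjoint: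
  fixes B :: "'a::{real_inner,complete_space} \<Rightarrow> 'b::real_inner"
  assumes "bounded_linear B"
  shows "x \<bullet> adjoint B y = B x \<bullet> y"
proof -
  have "\<exists>w. \<forall>x. B x \<bullet> y = x \<bullet> w" for y
  proof -
    have "bounded_linear (\<lambda>x. B x \<bullet> y)"
      using assms bounded_linear_inner_left bounded_linear_compose by fastforce
    then obtain w where "\<And>x. B x \<bullet> y = w \<bullet> x"
      by (rule riesz_representation) blast
    then show ?thesis by (metis inner_commute)
  qed
  then have "\<exists>B'. \<forall>x y. B x \<bullet> y = x \<bullet> B' y" by metis
  then have "\<forall>x y. B x \<bullet> y = x \<bullet> adjoint B y"
    unfolding adjoint_def by (rule someI_ex)
  then show ?thesis by simp
qed

lemma norm_le_of_inner_le:
  fixes w :: "'a::real_inner"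
  assumes "\<And>h. w \<bullet> h \<le> K * norm h" and "0 \<le> K"
  shows "norm w \<le> K"
  using assms(1)[of w] assms(2)
  by (cases "w = 0") (auto simp: power2_norm_eq_inner[symmetric] power2_eq_square)

lemma norm_adjoint_le:
  fixes B :: "'a::{real_inner,complete_space} \<Rightarrow> 'b::real_inner"
  assumes B: "bounded_linear B"
  shows "norm (adjoint B y) \<le> onorm B * norm y"
proof (rule norm_le_of_inner_le)
  show "adjoint B y \<bullet> h \<le> onorm B * norm y * norm h" for h
  proof -
    have "adjoint B y \<bullet> h = B h \<bullet> y"
      using inner_adjoint[OF B, of h y] by (simp add: inner_commute)
    also have "\<dots> \<le> norm (B h) * norm y" by (rule norm_cauchy_schwarz)
    also have "\<dots> \<le> (onorm B * norm h) * norm y"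
      using onorm[OF B, of h] by (intro mult_right_mono) auto
    finally show ?thesis by (simp add: mult_ac)
  qed
  show "0 \<le> onorm B * norm y" by (simp add: onorm_pos_le[OF B])
qed


section \<open>Landweber iterations with inexact steps\<close>

lemma young:
  fixes a b c :: real
  assumes "0 < c"
  shows "2 * a * b \<le> c * a\<^sup>2 + b\<^sup>2 / c"
proof -
  have "0 \<le> (c * a - b)\<^sup>2 / c" using assms by simp
  also have "\<dots> = c * a\<^sup>2 + b\<^sup>2 / c - 2 * a * b"
    using assms by (simp add: power2_eq_square field_simps)
  finally show ?thesis by simp
qed

text \<open>
  A gradient method for \<open>G x = G \<theta>\<^sub>e\<close> whose steps are only approximately Landweber steps. The data
  residual \<open>G (\<theta> j) - G \<theta>\<^sub>e\<close> is replaced by a perturbed one, \<open>v j\<close>, with error at most \<open>\<delta> j\<close>, and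
  the adjoint of \<open>G' (\<theta> j)\<close> is replaced by an approximate one; \<open>step_inner\<close> says that the relative
  error of the adjoint is \<open>C \<delta> j\<close>, tested against an arbitrary direction. The coefficient in
  the monotonicity condition is split so that \<open>m + \<mu> / 2\<close> dominates the squared step bound \<open>M\<^sup>2\<close> and
  the other half of \<open>\<mu>\<close> pays for the perturbations. Everything is required only at points of the
  ball, since only there is the problem controlled; that the iterates stay there is part of what is
  proved.
\<close>

locale inexact_landweber =
  fixes G :: "'x::{real_inner,complete_space} \<Rightarrow> 'y::real_inner"
    and G' :: "'x \<Rightarrow> 'x \<Rightarrow> 'y"
    and \<theta>\<^sub>e :: 'x
    and R m \<mu> K C M \<sigma> \<nu> \<eta> :: real
    and \<theta> :: "nat \<Rightarrow> 'x" and v :: "nat \<Rightarrow> 'y" and \<delta> :: "nat \<Rightarrow> real"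
  assumes K: "0 < K" and C: "0 \<le> C"
    and \<sigma>\<nu>: "0 \<le> \<nu>" "\<nu> < \<sigma> / 2" "\<sigma> < \<mu>"
    and \<eta>: "0 < \<eta>" "(1 + \<eta>) * M\<^sup>2 < m + \<mu> / 2"
    and linear: "\<And>x. x \<in> ball \<theta>\<^sub>e R \<Longrightarrow> linear (G' x)"
    and monotone: "\<And>x. x \<in> ball \<theta>\<^sub>e R \<Longrightarrow>
          (m + \<mu>) * (norm (G x - G \<theta>\<^sub>e))\<^sup>2 \<le> 2 * ((G x - G \<theta>\<^sub>e) \<bullet> G' x (x - \<theta>\<^sub>e))"
    and tangential_cone: "\<And>x x'. x \<in> ball \<theta>\<^sub>e R \<Longrightarrow> x' \<in> ball \<theta>\<^sub>e R \<Longrightarrow>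
          norm (G' x (x - x')) \<le> K * norm (G x - G x')"
    and start: "\<theta> 0 \<in> ball \<theta>\<^sub>e R"
    and misfit: "\<And>j. \<theta> j \<in> ball \<theta>\<^sub>e R \<Longrightarrow> norm (v j - (G (\<theta> j) - G \<theta>\<^sub>e)) \<le> \<delta> j"
    and step_norm: "\<And>j. \<theta> j \<in> ball \<theta>\<^sub>e R \<Longrightarrow> norm (\<theta> j - \<theta> (Suc j)) \<le> M * norm (v j)"
    and step_inner: "\<And>j h. \<theta> j \<in> ball \<theta>\<^sub>e R \<Longrightarrow>
          \<bar>(\<theta> j - \<theta> (Suc j)) \<bullet> h - v j \<bullet> G' (\<theta> j) h\<bar> \<le> C * \<delta> j * norm (v j) * norm h"
    and stopping: "\<And>j. \<theta> j \<in> ball \<theta>\<^sub>e R \<Longrightarrow>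
          (2 * (K + C * R)\<^sup>2 / (\<mu> - \<sigma>) + (1 + 1 / \<eta>) * M\<^sup>2 + 2 * C * R) * (\<delta> j)\<^sup>2
            \<le> (\<sigma> / 2 - \<nu>) * (norm (G (\<theta> j) - G \<theta>\<^sub>e))\<^sup>2"
begin

definition residual :: "nat \<Rightarrow> real" where
  "residual j = norm (G (\<theta> j) - G \<theta>\<^sub>e)"

text \<open>
  The factor in front of the squared residual that is left over in the decrease of the squared
  error. Its positivity comes from the strict inequality for \<open>\<eta>\<close>, even when \<open>\<nu> = 0\<close>.
\<close>

definition gain :: real where
  "gain = \<nu> + (m + \<mu> / 2 - (1 + \<eta>) * M\<^sup>2)"

lemma gain_pos: "0 < gain"
  using \<sigma>\<nu> \<eta> by (simp add: gain_def)

lemma residual_nonneg [simp]: "0 \<le> residual j"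
  by (simp add: residual_def)

lemma radius_pos: "0 < R"
  using start by (metis ball_eq_empty empty_iff not_less)

lemma misfit_nonneg: "\<theta> j \<in> ball \<theta>\<^sub>e R \<Longrightarrow> 0 \<le> \<delta> j"
  using misfit[of j] norm_ge_zero order_trans by blast

lemma norm_data_le:
  assumes "\<theta> j \<in> ball \<theta>\<^sub>e R"
  shows "norm (v j) \<le> residual j + \<delta> j"
  using misfit[OF assms] norm_triangle_sub[of "v j" "G (\<theta> j) - G \<theta>\<^sub>e"]
  by (simp add: residual_def)

text \<open>
  Write \<open>e = \<theta> j - \<theta>\<^sub>e\<close> and \<open>s\<close> for the step, and expand
  \<open>\<parallel>e - s\<parallel>\<^sup>2 = \<parallel>e\<parallel>\<^sup>2 - 2 (s \<bullet> e) + \<parallel>s\<parallel>\<^sup>2\<close>. For an exact step, monotonicity gives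
  \<open>2 (s \<bullet> e) \<ge> (m + \<mu>) a\<^sup>2\<close> with \<open>a\<close> the residual. The inexactness costs a term
  \<open>2 (K + C R) a \<delta>\<close> and terms in \<open>\<delta>\<^sup>2\<close>. Young's inequality splits the mixed terms: with weight
  \<open>(\<mu> - \<sigma>) / 2\<close> in the inner product and with weight \<open>\<eta>\<close> in \<open>\<parallel>v j\<parallel>\<^sup>2\<close>. The stopping rule is
  made to bound all resulting terms in \<open>\<delta>\<^sup>2\<close> by \<open>(\<sigma> / 2 - \<nu>) a\<^sup>2\<close>.
\<close>

lemma squared_error_decrease:
  assumes j: "\<theta> j \<in> ball \<theta>\<^sub>e R"
  shows "(norm (\<theta> (Suc j) - \<theta>\<^sub>e))\<^sup>2 + gain * (residual j)\<^sup>2 \<le> (norm (\<theta> j - \<theta>\<^sub>e))\<^sup>2"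
proof -
  define e where "e = \<theta> j - \<theta>\<^sub>e"
  define s where "s = \<theta> j - \<theta> (Suc j)"
  define \<Delta> where "\<Delta> = G (\<theta> j) - G \<theta>\<^sub>e"
  define a where "a = residual j"
  define d where "d = \<delta> j"
  define n where "n = norm (v j)"
  have a: "0 \<le> a" "a = norm \<Delta>" and d: "0 \<le> d" and n: "0 \<le> n" "n \<le> a + d"
    using misfit_nonneg[OF j] norm_data_le[OF j] by (auto simp: a_def d_def n_def \<Delta>_def residual_def)
  have e: "norm e \<le> R"
    using j by (simp add: e_def dist_norm norm_minus_commute)
  have CR: "0 \<le> C * R" using C radius_pos by simp
  have "n\<^sup>2 \<le> (a + d)\<^sup>2" using n by (intro power_mono) auto
  also have "\<dots> \<le> (1 + \<eta>) * a\<^sup>2 + (1 + 1 / \<eta>) * d\<^sup>2"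
    using young[OF \<eta>(1), of a d] by (simp add: power2_sum algebra_simps)
  finally have "M\<^sup>2 * n\<^sup>2 \<le> M\<^sup>2 * ((1 + \<eta>) * a\<^sup>2 + (1 + 1 / \<eta>) * d\<^sup>2)"
    by (intro mult_left_mono) auto
  moreover have "(norm s)\<^sup>2 \<le> M\<^sup>2 * n\<^sup>2"
    using step_norm[OF j] by (simp add: s_def n_def flip: power_mult_distrib)
      (intro power_mono, auto)
  ultimately have s_sq: "(norm s)\<^sup>2 \<le> (1 + \<eta>) * M\<^sup>2 * a\<^sup>2 + (1 + 1 / \<eta>) * M\<^sup>2 * d\<^sup>2"
    by (simp add: algebra_simps)
  have "\<bar>(v j - \<Delta>) \<bullet> G' (\<theta> j) e\<bar> \<le> norm (v j - \<Delta>) * norm (G' (\<theta> j) e)"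
    by (rule Cauchy_Schwarz_ineq2)
  also have "\<dots> \<le> d * (K * a)"
    using misfit[OF j] tangential_cone[OF j, of \<theta>\<^sub>e] radius_pos d
    by (intro mult_mono) (auto simp: d_def \<Delta>_def e_def a_def residual_def)
  finally have cross: "\<Delta> \<bullet> G' (\<theta> j) e - v j \<bullet> G' (\<theta> j) e \<le> d * (K * a)"
    by (simp add: inner_diff_left)
  have "v j \<bullet> G' (\<theta> j) e - s \<bullet> e \<le> C * d * n * norm e"
    using step_inner[OF j, of e] by (simp add: s_def d_def n_def abs_le_iff)
  also have "\<dots> \<le> C * d * (a + d) * R"
    using n e d C a(1) by (intro mult_mono mult_nonneg_nonneg) auto
  finally have "2 * (\<Delta> \<bullet> G' (\<theta> j) e) - 2 * (s \<bullet> e) \<le> 2 * (C * d * (a + d) * R) + 2 * (d * (K * a))"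
    using cross by linarith
  moreover have "(m + \<mu>) * a\<^sup>2 \<le> 2 * (\<Delta> \<bullet> G' (\<theta> j) e)"
    using monotone[OF j] by (simp add: a(2) \<Delta>_def e_def)
  ultimately have "(m + \<mu>) * a\<^sup>2 - 2 * (s \<bullet> e) \<le> 2 * (C * d * (a + d) * R) + 2 * (d * (K * a))"
    by linarith
  also have "\<dots> = 2 * a * ((K + C * R) * d) + 2 * C * R * d\<^sup>2"
    by (simp add: algebra_simps power2_eq_square)
  also have "2 * a * ((K + C * R) * d) \<le> (\<mu> - \<sigma>) / 2 * a\<^sup>2 + 2 * (K + C * R)\<^sup>2 / (\<mu> - \<sigma>) * d\<^sup>2"
    using young[of "(\<mu> - \<sigma>) / 2" a "(K + C * R) * d"] \<sigma>\<nu> by (simp add: power_mult_distrib)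
  finally have "(m + \<mu>) * a\<^sup>2 - 2 * (s \<bullet> e)
      \<le> (\<mu> - \<sigma>) / 2 * a\<^sup>2 + 2 * (K + C * R)\<^sup>2 / (\<mu> - \<sigma>) * d\<^sup>2 + 2 * C * R * d\<^sup>2"
    by simp
  moreover have "(norm (e - s))\<^sup>2 = (norm e)\<^sup>2 - 2 * (s \<bullet> e) + (norm s)\<^sup>2"
    by (simp add: power2_norm_eq_inner inner_simps inner_commute)
  moreover have "2 * (K + C * R)\<^sup>2 / (\<mu> - \<sigma>) * d\<^sup>2 + (1 + 1 / \<eta>) * M\<^sup>2 * d\<^sup>2 + 2 * C * R * d\<^sup>2
      \<le> (\<sigma> / 2 - \<nu>) * a\<^sup>2"
    using stopping[OF j] by (simp add: d_def a_def residual_def algebra_simps)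
  ultimately have "(norm (e - s))\<^sup>2 \<le> (norm e)\<^sup>2 - (m + \<mu>) * a\<^sup>2 + (\<mu> - \<sigma>) / 2 * a\<^sup>2
      + (1 + \<eta>) * M\<^sup>2 * a\<^sup>2 + (\<sigma> / 2 - \<nu>) * a\<^sup>2"
    using s_sq by linarith
  also have "\<dots> = (norm e)\<^sup>2 - gain * a\<^sup>2"
    by (simp add: gain_def algebra_simps) (simp add: field_simps)
  finally show ?thesis
    by (simp add: e_def s_def a_def)
qed

lemma iterate_in_ball: "\<theta> j \<in> ball \<theta>\<^sub>e R"
proof (induction j)
  case (Suc j)
  have "(norm (\<theta> (Suc j) - \<theta>\<^sub>e))\<^sup>2 \<le> (norm (\<theta> j - \<theta>\<^sub>e))\<^sup>2"
    using squared_error_decrease[OF Suc] gain_pos by (smt (verit) mult_nonneg_nonneg zero_le_power2)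
  then have "norm (\<theta> (Suc j) - \<theta>\<^sub>e) \<le> norm (\<theta> j - \<theta>\<^sub>e)"
    by (rule power2_le_imp_le) simp
  then show ?case
    using Suc by (simp add: dist_norm norm_minus_commute)
qed (rule start)

lemma squared_error_antimono: "decseq (\<lambda>j. (norm (\<theta> j - \<theta>\<^sub>e))\<^sup>2)"
proof (rule decseq_SucI)
  show "(norm (\<theta> (Suc j) - \<theta>\<^sub>e))\<^sup>2 \<le> (norm (\<theta> j - \<theta>\<^sub>e))\<^sup>2" for j
    using squared_error_decrease[OF iterate_in_ball, of j] gain_pos
    by (smt (verit) mult_nonneg_nonneg zero_le_power2)
qed

lemma summable_squared_residual: "summable (\<lambda>j. (residual j)\<^sup>2)"
proof (rule summableI_nonneg_bounded)
  show "(\<Sum>i<n. (residual i)\<^sup>2) \<le> (norm (\<theta> 0 - \<theta>\<^sub>e))\<^sup>2 / gain" for n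
  proof -
    have "(norm (\<theta> n - \<theta>\<^sub>e))\<^sup>2 + gain * (\<Sum>i<n. (residual i)\<^sup>2) \<le> (norm (\<theta> 0 - \<theta>\<^sub>e))\<^sup>2"
    proof (induction n)
      case (Suc n)
      then show ?case
        using squared_error_decrease[OF iterate_in_ball, of n] by (simp add: distrib_left)
    qed simp
    then have "gain * (\<Sum>i<n. (residual i)\<^sup>2) \<le> (norm (\<theta> 0 - \<theta>\<^sub>e))\<^sup>2"
      by (smt (verit) zero_le_power2)
    then show ?thesis
      using gain_pos by (simp add: field_simps)
  qed
qed simp

lemma residual_tendsto_0: "residual \<longlonglongrightarrow> 0"
  using summable_LIMSEQ_zero[OF summable_squared_residual] by simp

text \<open>
  The constant in the stopping rule is positive because \<open>K > 0\<close>, so the rule bounds every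
  perturbation by a multiple of the residual.
\<close>

lemma misfit_le_residual:
  obtains B where "0 \<le> B" "\<And>j. \<delta> j \<le> B * residual j"
proof -
  define c where "c = 2 * (K + C * R)\<^sup>2 / (\<mu> - \<sigma>) + (1 + 1 / \<eta>) * M\<^sup>2 + 2 * C * R"
  have "0 < K + C * R" using K C radius_pos by (simp add: add_pos_nonneg)
  then have c: "0 < c"
    unfolding c_def using \<sigma>\<nu> \<eta> C radius_pos by (intro add_pos_nonneg) auto
  define B where "B = sqrt ((\<sigma> / 2 - \<nu>) / c)"
  have B: "0 \<le> B" "B\<^sup>2 = (\<sigma> / 2 - \<nu>) / c"
    using c \<sigma>\<nu> by (auto simp: B_def)
  have "\<delta> j \<le> B * residual j" for j
  proof (rule power2_le_imp_le)
    have "c * (\<delta> j)\<^sup>2 \<le> (\<sigma> / 2 - \<nu>) * (residual j)\<^sup>2"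
      using stopping[OF iterate_in_ball] by (simp add: c_def residual_def)
    then show "(\<delta> j)\<^sup>2 \<le> (B * residual j)\<^sup>2"
      using c by (simp add: power_mult_distrib B field_simps)
  qed (use B in simp)
  with B(1) show thesis by (rule that)
qed

text \<open>
  The step from \<open>i\<close> tested against the error at another index \<open>l\<close> is, up to the inexactness,
  \<open>v i \<bullet> G' (\<theta> i) (\<theta> l - \<theta>\<^sub>e)\<close>. Inserting \<open>\<theta> i\<close> splits the direction into two differences that start
  at \<open>\<theta> i\<close>, where the tangential cone condition applies; it leads to residuals at \<open>i\<close> and \<open>l\<close> only,
  so a quadratic bound in the residual at \<open>i\<close> follows when the one at \<open>l\<close> is no larger.
\<close>

lemma step_inner_error_le:
  obtains D where "0 \<le> D"
    "\<And>i l. residual l \<le> residual i \<Longrightarrow>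
       \<bar>(\<theta> i - \<theta> (Suc i)) \<bullet> (\<theta> l - \<theta>\<^sub>e)\<bar> \<le> D * (residual i)\<^sup>2"
proof -
  obtain B where B: "0 \<le> B" "\<And>j. \<delta> j \<le> B * residual j"
    by (rule misfit_le_residual) blast
  define D where "D = (1 + B) * (3 * K + C * B * R)"
  have D: "0 \<le> D"
    using B K C radius_pos by (simp add: D_def)
  have "\<bar>(\<theta> i - \<theta> (Suc i)) \<bullet> (\<theta> l - \<theta>\<^sub>e)\<bar> \<le> D * (residual i)\<^sup>2"
    if le: "residual l \<le> residual i" for i l
  proof -
    note i = iterate_in_ball[of i] and l = iterate_in_ball[of l]
    define a where "a = residual i"
    have a: "0 \<le> a" by (simp add: a_def)
    have \<delta>: "0 \<le> \<delta> i" "\<delta> i \<le> B * a"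
      using misfit_nonneg[OF i] B(2) by (auto simp: a_def)
    have v: "norm (v i) \<le> (1 + B) * a"
      using norm_data_le[OF i] \<delta> by (simp add: a_def distrib_right)
    have e: "norm (\<theta> l - \<theta>\<^sub>e) \<le> R"
      using l by (simp add: dist_norm norm_minus_commute)
    have "G' (\<theta> i) (\<theta> l - \<theta>\<^sub>e) = G' (\<theta> i) (\<theta> i - \<theta>\<^sub>e) - G' (\<theta> i) (\<theta> i - \<theta> l)"
      by (simp flip: linear_diff[OF linear[OF i]])
    then have "norm (G' (\<theta> i) (\<theta> l - \<theta>\<^sub>e))
        \<le> norm (G' (\<theta> i) (\<theta> i - \<theta>\<^sub>e)) + norm (G' (\<theta> i) (\<theta> i - \<theta> l))"
      by (simp add: norm_triangle_ineq4)
    also have "\<dots> \<le> K * norm (G (\<theta> i) - G \<theta>\<^sub>e) + K * norm (G (\<theta> i) - G (\<theta> l))"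
      using tangential_cone[OF i, of \<theta>\<^sub>e] tangential_cone[OF i l] radius_pos by (intro add_mono) auto
    also have "\<dots> \<le> K * a + K * (a + residual l)"
      using norm_triangle_ineq4[of "G (\<theta> i) - G \<theta>\<^sub>e" "G (\<theta> l) - G \<theta>\<^sub>e"] K
      by (intro add_mono mult_left_mono) (auto simp: a_def residual_def)
    also have "\<dots> \<le> 3 * K * a"
      using mult_left_mono[OF le, of K] K by (simp add: a_def algebra_simps)
    finally have G': "norm (G' (\<theta> i) (\<theta> l - \<theta>\<^sub>e)) \<le> 3 * K * a" .
    have "\<bar>(\<theta> i - \<theta> (Suc i)) \<bullet> (\<theta> l - \<theta>\<^sub>e)\<bar>
        \<le> \<bar>v i \<bullet> G' (\<theta> i) (\<theta> l - \<theta>\<^sub>e)\<bar> + C * \<delta> i * norm (v i) * norm (\<theta> l - \<theta>\<^sub>e)"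
      using step_inner[OF i, of "\<theta> l - \<theta>\<^sub>e"] by linarith
    also have "\<dots> \<le> norm (v i) * norm (G' (\<theta> i) (\<theta> l - \<theta>\<^sub>e)) + C * \<delta> i * norm (v i) * norm (\<theta> l - \<theta>\<^sub>e)"
      by (simp add: Cauchy_Schwarz_ineq2)
    also have "\<dots> \<le> ((1 + B) * a) * (3 * K * a) + C * (B * a) * ((1 + B) * a) * R"
      using v G' \<delta> e a B(1) C K by (intro add_mono mult_mono mult_nonneg_nonneg) auto
    also have "\<dots> = D * a\<^sup>2"
      by (simp add: D_def power2_eq_square algebra_simps)
    finally show ?thesis by (simp add: a_def)
  qed
  with D show thesis by (rule that)
qed

text \<open>
  From \<open>\<parallel>a - b\<parallel>\<^sup>2 = \<parallel>a\<parallel>\<^sup>2 - \<parallel>b\<parallel>\<^sup>2 - 2 (a - b) \<bullet> b\<close> for the errors at two indices, the distance of two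
  iterates is controlled by the change of the squared error, which is a convergent sequence, and by
  an inner product of the accumulated steps with the error at the second index. When that index has
  the smallest residual of the range, the inner product is bounded by a piece of the convergent sum
  of squared residuals. Two arbitrary iterates are compared through such an index between them.
\<close>

lemma Cauchy_iterates: "Cauchy \<theta>"
proof -
  obtain D where D: "0 \<le> D"
    "\<And>i l. residual l \<le> residual i \<Longrightarrow>
       \<bar>(\<theta> i - \<theta> (Suc i)) \<bullet> (\<theta> l - \<theta>\<^sub>e)\<bar> \<le> D * (residual i)\<^sup>2"
    by (rule step_inner_error_le) blast
  define E where "E n = (norm (\<theta> n - \<theta>\<^sub>e))\<^sup>2" for n
  define P where "P n = (\<Sum>i<n. (residual i)\<^sup>2)" for n
  have telescope: "\<bar>(\<theta> p - \<theta> q) \<bullet> (\<theta> l - \<theta>\<^sub>e)\<bar> \<le> D * (P q - P p)"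
    if "p \<le> q" "\<And>i. p \<le> i \<Longrightarrow> i \<le> q \<Longrightarrow> residual l \<le> residual i" for p q l
    using that
  proof (induction rule: dec_induct)
    case (step q)
    have "\<bar>(\<theta> p - \<theta> (Suc q)) \<bullet> (\<theta> l - \<theta>\<^sub>e)\<bar>
        \<le> \<bar>(\<theta> p - \<theta> q) \<bullet> (\<theta> l - \<theta>\<^sub>e)\<bar> + \<bar>(\<theta> q - \<theta> (Suc q)) \<bullet> (\<theta> l - \<theta>\<^sub>e)\<bar>"
      by (simp add: inner_diff_left)
    also have "\<dots> \<le> D * (P q - P p) + D * (residual q)\<^sup>2"
      using step by (intro add_mono D(2) step.IH) auto
    also have "\<dots> = D * (P (Suc q) - P p)"
      by (simp add: P_def algebra_simps)
    finally show ?case .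
  qed simp
  have expand: "(norm (\<theta> p - \<theta> l))\<^sup>2 = E p - E l - 2 * ((\<theta> p - \<theta> l) \<bullet> (\<theta> l - \<theta>\<^sub>e))" for p l
    by (simp add: E_def power2_norm_eq_inner inner_simps inner_commute)
  have "Cauchy E"
  proof -
    have "Bseq E"
      unfolding Bseq_eq_bounded E_def[abs_def]
      using squared_error_antimono by (intro boundedI[of _ "(norm (\<theta> 0 - \<theta>\<^sub>e))\<^sup>2"]) (auto simp: decseq_def)
    then show ?thesis
      using squared_error_antimono by (simp add: E_def[abs_def] Bseq_monoseq_convergent convergent_Cauchy decseq_imp_monoseq)
  qed
  have "Cauchy P"
    using summable_squared_residual unfolding P_def[abs_def]
    by (simp add: summable_iff_convergent convergent_Cauchy)
  show ?thesis
  proof (rule metric_CauchyI)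
    fix \<epsilon> :: real assume \<epsilon>: "0 < \<epsilon>"
    define e where "e = (\<epsilon> / 2)\<^sup>2 / (1 + 2 * D)"
    have e: "0 < e" "(1 + 2 * D) * e = (\<epsilon> / 2)\<^sup>2"
      using \<epsilon> D(1) by (auto simp: e_def)
    obtain N1 where N1: "\<And>p q. N1 \<le> p \<Longrightarrow> N1 \<le> q \<Longrightarrow> \<bar>E p - E q\<bar> < e"
      using metric_CauchyD[OF \<open>Cauchy E\<close> e(1)] unfolding dist_real_def by blast
    obtain N2 where N2: "\<And>p q. N2 \<le> p \<Longrightarrow> N2 \<le> q \<Longrightarrow> \<bar>P p - P q\<bar> < e"
      using metric_CauchyD[OF \<open>Cauchy P\<close> e(1)] unfolding dist_real_def by blast
    define N where "N = max N1 N2"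
    have close: "norm (\<theta> p - \<theta> l) < \<epsilon> / 2"
      if pl: "N \<le> p" "N \<le> l"
        and inner: "\<bar>(\<theta> p - \<theta> l) \<bullet> (\<theta> l - \<theta>\<^sub>e)\<bar> \<le> D * \<bar>P p - P l\<bar>" for p l
    proof -
      have "D * \<bar>P p - P l\<bar> \<le> D * e"
        using N2[of p l] pl D(1) by (intro mult_left_mono) (auto simp: N_def)
      then have "(norm (\<theta> p - \<theta> l))\<^sup>2 < e + 2 * (D * e)"
        using N1[of p l] pl inner expand[of p l] by (simp add: N_def abs_less_iff abs_le_iff)
      also have "\<dots> = (\<epsilon> / 2)\<^sup>2" using e(2) by (simp add: algebra_simps)
      finally show ?thesis using \<epsilon> by (intro power2_less_imp_less[of _ "\<epsilon> / 2"]) auto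
    qed
    have "dist (\<theta> j) (\<theta> k) < \<epsilon>" if jk: "N \<le> j" "j \<le> k" for j k
    proof -
      \<comment> \<open>compare both ends with the iterate of smallest residual between them\<close>
      have "Min (residual ` {j..k}) \<in> residual ` {j..k}"
        using jk by (intro Min_in) auto
      then obtain l where l: "j \<le> l" "l \<le> k" "residual l = Min (residual ` {j..k})"
        by auto
      then have min: "residual l \<le> residual i" if "j \<le> i" "i \<le> k" for i
        using that by auto
      have mono: "P p \<le> P q" if "p \<le> q" for p q
        unfolding P_def using that by (intro sum_mono2) auto
      have "norm (\<theta> j - \<theta> l) < \<epsilon> / 2"
      proof (rule close)
        show "\<bar>(\<theta> j - \<theta> l) \<bullet> (\<theta> l - \<theta>\<^sub>e)\<bar> \<le> D * \<bar>P j - P l\<bar>"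
          using telescope[of j l l] min l mono[of j l] by simp
      qed (use jk l in auto)
      moreover have "norm (\<theta> k - \<theta> l) < \<epsilon> / 2"
      proof (rule close)
        have "\<bar>(\<theta> k - \<theta> l) \<bullet> (\<theta> l - \<theta>\<^sub>e)\<bar> = \<bar>(\<theta> l - \<theta> k) \<bullet> (\<theta> l - \<theta>\<^sub>e)\<bar>"
          by (metis abs_minus_cancel inner_minus_left minus_diff_eq)
        then show "\<bar>(\<theta> k - \<theta> l) \<bullet> (\<theta> l - \<theta>\<^sub>e)\<bar> \<le> D * \<bar>P k - P l\<bar>"
          using telescope[of l k l] min l mono[of l k] by simp
      qed (use jk l in auto)
      ultimately show ?thesis
        using dist_triangle_half_l[of "\<theta> j" "\<theta> l" \<epsilon> "\<theta> k"] by (simp add: dist_norm)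
    qed
    then have "dist (\<theta> j) (\<theta> k) < \<epsilon>" if "N \<le> j" "N \<le> k" for j k
      using that by (metis dist_commute nle_le)
    then show "\<exists>N. \<forall>j\<ge>N. \<forall>k\<ge>N. dist (\<theta> j) (\<theta> k) < \<epsilon>" by blast
  qed
qed

theorem iterates_tendsto_solution:
  assumes "continuous_on UNIV G"
  obtains x where "\<theta> \<longlonglongrightarrow> x" "(\<lambda>j. G (\<theta> j)) \<longlonglongrightarrow> G \<theta>\<^sub>e" "G x = G \<theta>\<^sub>e"
proof -
  obtain x where x: "\<theta> \<longlonglongrightarrow> x"
    using Cauchy_iterates Cauchy_convergent convergent_def by blast
  have images: "(\<lambda>j. G (\<theta> j)) \<longlonglongrightarrow> G \<theta>\<^sub>e"
    using residual_tendsto_0 unfolding residual_def[abs_def]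
    by (simp add: tendsto_norm_zero_iff LIM_zero_iff)
  moreover have "(\<lambda>j. G (\<theta> j)) \<longlonglongrightarrow> G x"
    using assms x by (simp add: continuous_on_tendsto_compose)
  ultimately have "G x = G \<theta>\<^sub>e" by (rule LIMSEQ_unique[rotated])
  with x images show thesis by (rule that)
qed

end

section \<open>The duality between square integrable functions\<close>

lemma complete_time_measure: "complete_measure (time_measure T)"
proof
  fix A B assume "B \<subseteq> A" "A \<in> null_sets (time_measure T)"
  then have "B \<subseteq> {0<..<T}" "B \<in> null_sets lebesgue"
    unfolding time_measure_def by (auto simp: null_sets_restrict_space intro: completion.complete2)
  then show "B \<in> sets (time_measure T)"
    unfolding time_measure_def by (simp add: sets_restrict_space_iff null_setsD2)
qed

text \<open>
  On a complete measure space it is harmless that the representatives of square integrable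
  functions are determined only up to null sets.
\<close>

lemma (in complete_measure) measurable_AE_eq:
  assumes f: "f \<in> measurable M N" and eq: "AE x in M. f x = g x"
    and g: "\<And>x. x \<in> space M \<Longrightarrow> g x \<in> space N"
  shows "g \<in> measurable M N"
proof (rule measurableI)
  fix A assume A: "A \<in> sets N"
  show "g -` A \<inter> space M \<in> sets M"
  proof (rule in_sets_AE)
    show "AE x in M. (x \<in> f -` A \<inter> space M) = (x \<in> g -` A \<inter> space M)"
      using eq by eventually_elim auto
  qed (use measurable_sets[OF f A] in auto)
qed (rule g)

text \<open>
  Strong measurability is handled through approximating simple functions, since the spaces involved
  need not be second countable and Borel measurability need then not be preserved by pairing.
\<close>

lemma strongly_measurable_compose2:
  assumes g: "strongly_measurable M g" and h: "strongly_measurable M h"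
    and \<Phi>: "continuous_on UNIV (\<lambda>(x, y). \<Phi> x y)"
  shows "strongly_measurable M (\<lambda>t. \<Phi> (g t) (h t))"
proof -
  obtain r where r: "\<And>i::nat. simple_function M (r i)" "AE t in M. (\<lambda>i. r i t) \<longlonglongrightarrow> g t"
    using g unfolding strongly_measurable_def by blast
  obtain s where s: "\<And>i::nat. simple_function M (s i)" "AE t in M. (\<lambda>i. s i t) \<longlonglongrightarrow> h t"
    using h unfolding strongly_measurable_def by blast
  have "AE t in M. (\<lambda>i. \<Phi> (r i t) (s i t)) \<longlonglongrightarrow> \<Phi> (g t) (h t)"
    using r(2) s(2)
  proof eventually_elim
    case (elim t)
    then have "(\<lambda>i. (r i t, s i t)) \<longlonglongrightarrow> (g t, h t)"
      by (rule tendsto_Pair)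
    then show ?case
      using continuous_on_tendsto_compose[OF \<Phi>, of "\<lambda>i. (r i t, s i t)" "(g t, h t)"] by simp
  qed
  moreover have "simple_function M (\<lambda>t. \<Phi> (r i t) (s i t))" for i
    by (rule simple_function_compose2[OF r(1) s(1)])
  ultimately show ?thesis
    unfolding strongly_measurable_def by (intro exI[of _ "\<lambda>i t. \<Phi> (r i t) (s i t)"] conjI allI)
qed

lemma strongly_measurable_compose:
  assumes g: "strongly_measurable M g" and \<Phi>: "continuous_on UNIV \<Phi>"
  shows "strongly_measurable M (\<lambda>t. \<Phi> (g t))"
proof -
  have "continuous_on UNIV (\<lambda>(x, y). \<Phi> x)"
    unfolding split_beta by (intro continuous_on_compose2[OF \<Phi>] continuous_intros) auto
  then show ?thesis
    using strongly_measurable_compose2[OF g g, of "\<lambda>x y. \<Phi> x"] by simp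
qed

lemma (in complete_measure) borel_measurable_of_strongly:
  fixes g :: "'a \<Rightarrow> real"
  assumes "strongly_measurable M g"
  shows "g \<in> borel_measurable M"
proof -
  obtain s where s: "\<And>i::nat. simple_function M (s i)" "AE t in M. (\<lambda>i. s i t) \<longlonglongrightarrow> g t"
    using assms unfolding strongly_measurable_def by blast
  have [measurable]: "s i \<in> borel_measurable M" for i
    by (rule borel_measurable_simple_function[OF s(1)])
  have "(\<lambda>t. lim (\<lambda>i. s i t)) \<in> borel_measurable M"
    by measurable
  moreover have "AE t in M. lim (\<lambda>i. s i t) = g t"
    using s(2) by eventually_elim (simp add: limI)
  ultimately show ?thesis
    by (rule measurable_AE_eq) simp
qed

lemma borel_measurable_time:
  "strongly_measurable (time_measure T) g \<Longrightarrow> (g :: real \<Rightarrow> real) \<in> borel_measurable (time_measure T)"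
  by (rule complete_measure.borel_measurable_of_strongly[OF complete_time_measure])

lemma integral_time_cong_AE:
  fixes f g :: "real \<Rightarrow> real"
  assumes f: "f \<in> borel_measurable (time_measure T)" and eq: "AE t in time_measure T. f t = g t"
  shows "integral\<^sup>L (time_measure T) f = integral\<^sup>L (time_measure T) g"
  using complete_measure.measurable_AE_eq[OF complete_time_measure f eq] f eq
  by (intro integral_cong_AE) auto

lemma L2_dominated:
  assumes "strongly_measurable (time_measure T) g" "h \<in> L2 T"
    and "AE t in time_measure T. norm (g t) \<le> c * norm (h t)"
  shows "g \<in> L2 T"
proof -
  have "integrable (time_measure T) (\<lambda>t. (norm (g t))\<^sup>2)"
  proof (rule Bochner_Integration.integrable_bound)
    show "integrable (time_measure T) (\<lambda>t. c\<^sup>2 * (norm (h t))\<^sup>2)"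
      using assms(2) by (simp add: L2_def)
    show "(\<lambda>t. (norm (g t))\<^sup>2) \<in> borel_measurable (time_measure T)"
      by (intro borel_measurable_time strongly_measurable_compose[OF assms(1)] continuous_intros)
    show "AE t in time_measure T. norm ((norm (g t))\<^sup>2) \<le> norm (c\<^sup>2 * (norm (h t))\<^sup>2)"
      using assms(3) by eventually_elim (simp flip: power_mult_distrib add: power_mono)
  qed
  with assms(1) show ?thesis by (simp add: L2_def)
qed

lemma continuous_blinfun_eval: "continuous_on UNIV (\<lambda>(b, x). blinfun_apply b x)"
  unfolding split_beta by (intro continuous_intros)

lemma integrable_duality:
  fixes b :: "real \<Rightarrow> 'a::real_normed_vector dual"
  assumes "b \<in> L2 T" "w \<in> L2 T"
  shows "integrable (time_measure T) (\<lambda>t. b t (w t))"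
proof (rule Bochner_Integration.integrable_bound)
  show "integrable (time_measure T) (\<lambda>t. (norm (b t))\<^sup>2 + (norm (w t))\<^sup>2)"
    using assms by (simp add: L2_def)
  show "(\<lambda>t. b t (w t)) \<in> borel_measurable (time_measure T)"
    using assms unfolding L2_def
    by (intro borel_measurable_time strongly_measurable_compose2[OF _ _ continuous_blinfun_eval]) auto
  show "AE t in time_measure T. norm (b t (w t)) \<le> norm ((norm (b t))\<^sup>2 + (norm (w t))\<^sup>2)"
  proof (rule AE_I2)
    fix t
    have "\<bar>b t (w t)\<bar> \<le> norm (b t) * norm (w t)"
      using norm_blinfun[of "b t" "w t"] by simp
    also have "2 * \<dots> \<le> (norm (b t))\<^sup>2 + (norm (w t))\<^sup>2"
      using sum_squares_bound[of "norm (b t)" "norm (w t)"] by simp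
    finally show "norm (b t (w t)) \<le> norm ((norm (b t))\<^sup>2 + (norm (w t))\<^sup>2)"
      by simp
  qed
qed

lemma
  assumes "L2_space T \<rho>"
  shows L2_space_L2: "\<rho> v \<in> L2 T"
    and L2_space_add: "AE t in time_measure T. \<rho> (v + w) t = \<rho> v t + \<rho> w t"
    and L2_space_scaleR: "AE t in time_measure T. \<rho> (c *\<^sub>R v) t = c *\<^sub>R \<rho> v t"
    and L2_space_norm: "norm v = sqrt (\<integral>t. (norm (\<rho> v t))\<^sup>2 \<partial>time_measure T)"
    and L2_space_surj: "g \<in> L2 T \<Longrightarrow> \<exists>v. AE t in time_measure T. \<rho> v t = g t"
proof -
  note D = assms[unfolded L2_space_def]
  show "\<rho> v \<in> L2 T"
    by (rule D[THEN conjunct1, THEN spec])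
  show "AE t in time_measure T. \<rho> (v + w) t = \<rho> v t + \<rho> w t"
    by (rule D[THEN conjunct2, THEN conjunct1, THEN spec, THEN spec])
  show "AE t in time_measure T. \<rho> (c *\<^sub>R v) t = c *\<^sub>R \<rho> v t"
    by (rule D[THEN conjunct2, THEN conjunct2, THEN conjunct1, THEN spec, THEN spec])
  show "norm v = sqrt (\<integral>t. (norm (\<rho> v t))\<^sup>2 \<partial>time_measure T)"
    by (rule D[THEN conjunct2, THEN conjunct2, THEN conjunct2, THEN conjunct1, THEN spec])
  show "\<exists>v. AE t in time_measure T. \<rho> v t = g t" if "g \<in> L2 T"
    by (rule D[THEN conjunct2, THEN conjunct2, THEN conjunct2, THEN conjunct2, THEN bspec, OF that])
qed

lemma L2_space_diff:
  assumes "L2_space T \<rho>"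
  shows "AE t in time_measure T. \<rho> (v - w) t = \<rho> v t - \<rho> w t"
  using L2_space_add[OF assms, of v "(-1) *\<^sub>R w"] L2_space_scaleR[OF assms, of "-1" w]
  by eventually_elim simp

lemma L2_space_norm_squared:
  assumes "L2_space T \<rho>"
  shows "(norm v)\<^sup>2 = (\<integral>t. (norm (\<rho> v t))\<^sup>2 \<partial>time_measure T)"
  by (subst L2_space_norm[OF assms]) simp

lemma L2_space_norm_le:
  assumes \<rho>: "L2_space T \<rho>" and \<rho>': "L2_space T \<rho>'" and "0 \<le> c"
    and le: "AE t in time_measure T. norm (\<rho>' w t) \<le> c * norm (\<rho> v t)"
  shows "norm w \<le> c * norm v"
proof (rule power2_le_imp_le)
  have "(norm w)\<^sup>2 \<le> (\<integral>t. c\<^sup>2 * (norm (\<rho> v t))\<^sup>2 \<partial>time_measure T)"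
    unfolding L2_space_norm_squared[OF \<rho>']
  proof (rule integral_mono_AE)
    show "AE t in time_measure T. (norm (\<rho>' w t))\<^sup>2 \<le> c\<^sup>2 * (norm (\<rho> v t))\<^sup>2"
      using le by eventually_elim (simp flip: power_mult_distrib add: power_mono)
  qed (use L2_space_L2[OF \<rho>, of v] L2_space_L2[OF \<rho>', of w] in \<open>simp_all add: L2_def\<close>)
  then show "(norm w)\<^sup>2 \<le> (c * norm v)\<^sup>2"
    by (simp add: L2_space_norm_squared[OF \<rho>] power_mult_distrib)
qed (simp add: assms)

lemma L2_space_eqI:
  assumes \<rho>: "L2_space T \<rho>" and eq: "AE t in time_measure T. \<rho> v t = \<rho> w t"
  shows "v = w"
proof -
  have "AE t in time_measure T. norm (\<rho> (v - w) t) \<le> 0 * norm (\<rho> v t)"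
    using L2_space_diff[OF \<rho>, of v w] eq by eventually_elim simp
  then have "norm (v - w) \<le> 0 * norm v"
    by (rule L2_space_norm_le[OF \<rho> \<rho>, rotated]) simp
  then show ?thesis by simp
qed

lemma L2_space_compose:
  fixes \<rho> :: "'s::real_normed_vector \<Rightarrow> real \<Rightarrow> 'a::real_normed_vector"
    and \<rho>' :: "'s'::real_normed_vector \<Rightarrow> real \<Rightarrow> 'b::real_normed_vector"
  assumes \<rho>: "L2_space T \<rho>" and \<rho>': "L2_space T \<rho>'" and c: "0 \<le> c"
    and \<Phi>: "continuous_on UNIV \<Phi>" "\<And>x. norm (\<Phi> x) \<le> c * norm x"
  obtains w where "AE t in time_measure T. \<rho>' w t = \<Phi> (\<rho> v t)" "norm w \<le> c * norm v"
proof -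
  note v = L2_space_L2[OF \<rho>, of v]
  have "(\<lambda>t. \<Phi> (\<rho> v t)) \<in> L2 T"
    using v by (intro L2_dominated[OF strongly_measurable_compose[OF _ \<Phi>(1)] v AE_I2[OF \<Phi>(2)]])
      (simp add: L2_def)
  then obtain w where w: "AE t in time_measure T. \<rho>' w t = \<Phi> (\<rho> v t)"
    using L2_space_surj[OF \<rho>'] by blast
  then have "AE t in time_measure T. norm (\<rho>' w t) \<le> c * norm (\<rho> v t)"
    by eventually_elim (simp add: \<Phi>)
  then have "norm w \<le> c * norm v"
    by (rule L2_space_norm_le[OF \<rho> \<rho>' c])
  with w show thesis by (rule that)
qed

text \<open>
  The norm determines the inner product: expand \<open>\<parallel>g + w\<parallel>\<^sup>2\<close> on both sides.
\<close>

lemma L2_space_inner: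
  fixes \<rho> :: "'s::real_inner \<Rightarrow> real \<Rightarrow> 'a::real_inner"
  assumes \<rho>: "L2_space T \<rho>"
  shows "g \<bullet> w = (\<integral>t. \<rho> g t \<bullet> \<rho> w t \<partial>time_measure T)"
proof -
  note g = L2_space_L2[OF \<rho>, of g] and w = L2_space_L2[OF \<rho>, of w]
  have "(\<lambda>t. blinfun_inner_right (\<rho> g t)) \<in> L2 T"
  proof (rule L2_dominated[OF _ g])
    show "strongly_measurable (time_measure T) (\<lambda>t. blinfun_inner_right (\<rho> g t))"
      by (rule strongly_measurable_compose) (use g in \<open>auto simp: L2_def
        intro: linear_continuous_on bounded_linear_blinfun_inner_right\<close>)
    show "AE t in time_measure T. norm (blinfun_inner_right (\<rho> g t)) \<le> 1 * norm (\<rho> g t)"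
      by (rule AE_I2) (simp add: norm_blinfun_bound Cauchy_Schwarz_ineq2)
  qed
  from integrable_duality[OF this w]
  have int: "integrable (time_measure T) (\<lambda>t. \<rho> g t \<bullet> \<rho> w t)" by simp
  have "(norm (g + w))\<^sup>2
      = (\<integral>t. (norm (\<rho> g t))\<^sup>2 + 2 * (\<rho> g t \<bullet> \<rho> w t) + (norm (\<rho> w t))\<^sup>2 \<partial>time_measure T)"
    unfolding L2_space_norm_squared[OF \<rho>]
  proof (rule integral_time_cong_AE)
    show "(\<lambda>t. (norm (\<rho> (g + w) t))\<^sup>2) \<in> borel_measurable (time_measure T)"
      using L2_space_L2[OF \<rho>, of "g + w"] by (auto simp: L2_def)
    show "AE t in time_measure T. (norm (\<rho> (g + w) t))\<^sup>2
        = (norm (\<rho> g t))\<^sup>2 + 2 * (\<rho> g t \<bullet> \<rho> w t) + (norm (\<rho> w t))\<^sup>2"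
      using L2_space_add[OF \<rho>, of g w]
      by eventually_elim (simp add: power2_norm_eq_inner inner_simps inner_commute)
  qed
  also have "\<dots> = (norm g)\<^sup>2 + 2 * (\<integral>t. \<rho> g t \<bullet> \<rho> w t \<partial>time_measure T) + (norm w)\<^sup>2"
    using g w int by (simp add: L2_def L2_space_norm_squared[OF \<rho>])
  also have "(norm (g + w))\<^sup>2 = (norm g)\<^sup>2 + 2 * (g \<bullet> w) + (norm w)\<^sup>2"
    by (simp add: power2_norm_eq_inner inner_simps inner_commute)
  finally show ?thesis by simp
qed

lemma norm_blinfun_inner_right: "norm (blinfun_inner_right x) = norm x"
proof (rule antisym)
  show "norm (blinfun_inner_right x) \<le> norm x"
    by (simp add: norm_blinfun_bound Cauchy_Schwarz_ineq2)
  show "norm x \<le> norm (blinfun_inner_right x)"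
    by (rule norm_le_of_inner_le) (use norm_blinfun[of "blinfun_inner_right x"] in \<open>auto simp: abs_le_iff\<close>)
qed

definition riesz :: "'a::{real_inner,complete_space} dual \<Rightarrow> 'a" where
  "riesz g = (SOME w. blinfun_inner_right w = g)"

lemma inner_riesz [simp]: "blinfun_inner_right (riesz g) = g"
proof -
  obtain w where w: "\<And>h. blinfun_apply g h = w \<bullet> h"
    by (rule riesz_representation[OF blinfun.bounded_linear_right[of g]]) blast
  have "blinfun_inner_right w = g"
    by (rule blinfun_eqI) (simp add: w)
  then show ?thesis unfolding riesz_def by (rule someI)
qed

lemma riesz_inner: "riesz g \<bullet> h = g h"
  using arg_cong[OF inner_riesz[of g], of "\<lambda>b. blinfun_apply b h"] by (simp del: inner_riesz)

lemma norm_riesz [simp]: "norm (riesz g) = norm g"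
  using norm_blinfun_inner_right[of "riesz g"] by simp

lemma riesz_diff: "riesz g - riesz h = riesz (g - h)"
proof -
  have "(riesz g - riesz h) \<bullet> x = riesz (g - h) \<bullet> x" for x
    by (simp add: inner_diff_left riesz_inner blinfun.diff_left)
  then show ?thesis using vector_eq_rdot by blast
qed

lemma continuous_on_riesz: "continuous_on UNIV riesz"
proof (rule continuous_onI)
  show "\<exists>d>0. \<forall>y\<in>UNIV. dist y x < d \<longrightarrow> dist (riesz y) (riesz x) \<le> e"
    if "0 < e" for x :: "'a dual" and e :: real
    using that by (intro exI[of _ e]) (simp add: dist_norm riesz_diff)
qed

text \<open>
  The functions with values in the dual of \<open>'u\<close> form the dual space of the functions with values
  in \<open>'u\<close>. Applying the Riesz map of \<open>'u\<close> at each time identifies the two isometrically and turns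
  the pairing into the inner product, so that duality reduces to the representation theorem.
\<close>

locale L2_duality =
  fixes T :: real
    and \<rho> :: "'l::{real_inner,complete_space} \<Rightarrow> real \<Rightarrow> 'u::{real_inner,complete_space}"
    and \<rho>' :: "'d::real_normed_vector \<Rightarrow> real \<Rightarrow> 'u dual"
  assumes \<rho>: "L2_space T \<rho>" and \<rho>': "L2_space T \<rho>'"
begin

definition dual_pair :: "'d \<Rightarrow> 'l \<Rightarrow> real" where
  "dual_pair b w = pairing T (\<rho>' b) (\<rho> w)"

lemma dual_pair_integral: "dual_pair b w = (\<integral>t. \<rho>' b t (\<rho> w t) \<partial>time_measure T)"
  by (simp add: dual_pair_def pairing_def)

lemma integrable_dual_pair: "integrable (time_measure T) (\<lambda>t. \<rho>' b t (\<rho> w t))"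
  by (rule integrable_duality) (rule L2_space_L2 \<rho> \<rho>')+

lemma dual_pair_cong:
  assumes "AE t in time_measure T. \<rho>' b t (\<rho> w t) = \<gamma> t"
  shows "dual_pair b w = (\<integral>t. \<gamma> t \<partial>time_measure T)"
  unfolding dual_pair_integral
  by (rule integral_time_cong_AE[OF _ assms]) (use integrable_dual_pair in auto)

lemma representer:
  obtains g where "\<And>w. dual_pair b w = g \<bullet> w" "norm g = norm b"
proof -
  obtain g where g: "AE t in time_measure T. \<rho> g t = riesz (\<rho>' b t)" "norm g \<le> 1 * norm b"
    by (rule L2_space_compose[OF \<rho>' \<rho> _ continuous_on_riesz, of 1 b]) auto
  have "AE t in time_measure T. norm (\<rho>' b t) \<le> 1 * norm (\<rho> g t)"
    using g(1) by eventually_elim simp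
  then have "norm b \<le> 1 * norm g"
    by (rule L2_space_norm_le[OF \<rho> \<rho>', rotated]) simp
  moreover have "dual_pair b w = g \<bullet> w" for w
    unfolding L2_space_inner[OF \<rho>]
    by (rule dual_pair_cong) (use g(1) in eventually_elim, simp add: riesz_inner)
  ultimately show thesis using g(2) by (intro that) auto
qed

lemma functional_dual_pair:
  assumes "bounded_linear \<psi>"
  obtains b where "\<And>w. dual_pair b w = \<psi> w"
proof -
  obtain g where g: "\<And>w. \<psi> w = g \<bullet> w"
    by (rule riesz_representation[OF assms]) blast
  obtain b where b: "AE t in time_measure T. \<rho>' b t = blinfun_inner_right (\<rho> g t)"
    by (rule L2_space_compose[OF \<rho> \<rho>', of 1 blinfun_inner_right g])
       (auto simp: norm_blinfun_inner_right intro: linear_continuous_on bounded_linear_blinfun_inner_right)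
  have "dual_pair b w = \<psi> w" for w
    unfolding g L2_space_inner[OF \<rho>] by (rule dual_pair_cong) (use b in eventually_elim, simp)
  then show thesis by (rule that)
qed

lemma norm_le_of_dual_pair_le:
  assumes "\<And>w. dual_pair b w \<le> K * norm w" "0 \<le> K"
  shows "norm b \<le> K"
proof -
  obtain g where "\<And>w. dual_pair b w = g \<bullet> w" "norm g = norm b"
    by (rule representer) blast
  then show ?thesis using norm_le_of_inner_le[of g K] assms by metis
qed

lemma bounded_bilinear_dual_pair: "bounded_bilinear dual_pair"
  and dual_pair_le: "\<bar>dual_pair b w\<bar> \<le> norm b * norm w"
proof -
  have add: "dual_pair (a + b) w = dual_pair a w + dual_pair b w" for a b w
  proof -
    have "dual_pair (a + b) w = (\<integral>t. \<rho>' a t (\<rho> w t) + \<rho>' b t (\<rho> w t) \<partial>time_measure T)"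
      by (rule dual_pair_cong)
         (use L2_space_add[OF \<rho>', of a b] in eventually_elim, simp add: blinfun.add_left)
    then show ?thesis by (simp add: dual_pair_integral integrable_dual_pair)
  qed
  have scale: "dual_pair (c *\<^sub>R b) w = c * dual_pair b w" for c b w
  proof -
    have "dual_pair (c *\<^sub>R b) w = (\<integral>t. c * \<rho>' b t (\<rho> w t) \<partial>time_measure T)"
      by (rule dual_pair_cong)
         (use L2_space_scaleR[OF \<rho>', of c b] in eventually_elim, simp add: blinfun.scaleR_left)
    then show ?thesis by (simp add: dual_pair_integral)
  qed
  have rep: "\<exists>g. (\<forall>w. dual_pair b w = g \<bullet> w) \<and> norm g = norm b" for b
    by (meson representer)
  show le: "\<bar>dual_pair b w\<bar> \<le> norm b * norm w" for b w
    using rep[of b] Cauchy_Schwarz_ineq2 by metis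
  show "bounded_bilinear dual_pair"
  proof
    show "dual_pair b (w + w') = dual_pair b w + dual_pair b w'" for b w w'
      using rep[of b] by (auto simp: inner_add_right)
    show "dual_pair b (c *\<^sub>R w) = c *\<^sub>R dual_pair b w" for b c w
      using rep[of b] by auto
    show "\<exists>K. \<forall>a b. norm (dual_pair a b) \<le> norm a * norm b * K"
      using le by (intro exI[of _ 1]) simp
  qed (simp_all add: add scale)
qed

sublocale dual_pair: bounded_bilinear dual_pair
  by (rule bounded_bilinear_dual_pair)

text \<open>
  This is the Banach space adjoint of \<open>B\<close> applied to \<open>q\<close>, with the identifications made: the
  element \<open>q\<close> acts on \<open>'d\<close> through the pairing, and the resulting functional on \<open>'l\<close> is an element of
  \<open>'d\<close> again.
\<close>

lemma operator_adjoint: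
  fixes B :: "'l \<Rightarrow>\<^sub>L 'd"
  obtains c where "\<And>w. dual_pair c w = dual_pair (B w) q" "norm c \<le> norm B * norm q"
proof -
  have "bounded_linear (\<lambda>w. dual_pair (B w) q)"
    by (intro dual_pair.bounded_linear_left[THEN bounded_linear_compose, unfolded o_def]
        blinfun.bounded_linear_right)
  then obtain c where c: "\<And>w. dual_pair c w = dual_pair (B w) q"
    by (rule functional_dual_pair) blast
  have "norm c \<le> norm B * norm q"
  proof (rule norm_le_of_dual_pair_le)
    show "dual_pair c w \<le> norm B * norm q * norm w" for w
    proof -
      have "dual_pair c w \<le> norm (B w) * norm q"
        using dual_pair_le[of "B w" q] by (simp add: c)
      also have "\<dots> \<le> (norm B * norm w) * norm q"
        by (intro mult_right_mono norm_blinfun) simp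
      finally show ?thesis by (simp add: mult_ac)
    qed
  qed simp
  with c show thesis by (rule that)
qed

definition parameter_adjoint :: "('x::real_normed_vector \<Rightarrow>\<^sub>L 'd) \<Rightarrow> 'l \<Rightarrow> 'x dual" where
  "parameter_adjoint K q = Blinfun (\<lambda>h. dual_pair (K h) q)"

lemma parameter_adjoint_apply [simp]: "parameter_adjoint K q h = dual_pair (K h) q"
proof -
  have "bounded_linear (\<lambda>h. dual_pair (K h) q)"
    by (intro dual_pair.bounded_linear_left[THEN bounded_linear_compose, unfolded o_def]
        blinfun.bounded_linear_right)
  then show ?thesis
    unfolding parameter_adjoint_def by (simp add: bounded_linear_Blinfun_apply)
qed

lemma norm_parameter_adjoint_le: "norm (parameter_adjoint K q) \<le> norm K * norm q"
proof (rule norm_blinfun_bound)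
  show "norm (parameter_adjoint K q h) \<le> norm K * norm q * norm h" for h
  proof -
    have "norm (parameter_adjoint K q h) \<le> norm (K h) * norm q"
      using dual_pair_le[of "K h" q] by simp
    also have "\<dots> \<le> (norm K * norm h) * norm q"
      by (intro mult_right_mono norm_blinfun) simp
    finally show ?thesis by (simp add: mult_ac)
  qed
qed simp

lemma parameter_adjoint_diff:
  "parameter_adjoint K' q' - parameter_adjoint K q
    = parameter_adjoint K' (q' - q) + parameter_adjoint (K' - K) q"
  by (rule blinfun_eqI)
     (simp add: blinfun.diff_left blinfun.add_left dual_pair.diff_left dual_pair.diff_right)

text \<open>
  Moving \<open>I\<close> to the other side of the inner product turns the integrand, tested against \<open>h\<close>, into
  the integrand of the pairing of \<open>K h'\<close> with \<open>q\<close>. Hence the weak integral exists, and it is the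
  image under \<open>I\<close> of the adjoint of \<open>K\<close> applied to \<open>q\<close>.
\<close>

lemma weak_integral_adjoint:
  fixes K :: "'x::{real_inner,complete_space} \<Rightarrow>\<^sub>L 'd" and I :: "'x dual \<Rightarrow>\<^sub>L 'x"
    and k :: "real \<Rightarrow> 'x \<Rightarrow>\<^sub>L 'u dual"
  assumes k: "\<And>h. AE t in time_measure T. \<rho>' (K h) t = k t h"
  shows "weak_integral T (\<lambda>t. I (banach_adjoint (k t) (bidual (\<rho> q t)))) = I (parameter_adjoint K q)"
    (is "weak_integral T ?g = ?w")
proof -
  have bidual: "bidual x \<phi> = \<phi> x" for x :: 'u and \<phi>
    unfolding bidual_def by (simp add: bounded_linear_Blinfun_apply blinfun.bounded_linear_left)
  have weak: "?w \<bullet> h = (\<integral>t. ?g t \<bullet> h \<partial>time_measure T)" for h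
  proof -
    \<comment> \<open>\<open>h'\<close> is the transpose of \<open>I\<close> applied to \<open>h\<close>; it lies in \<open>'x\<close> by reflexivity\<close>
    have "bounded_linear (\<lambda>x. I (blinfun_inner_right x) \<bullet> h)"
      by (intro bounded_linear_intros)
    then obtain h' where h': "\<And>x. I (blinfun_inner_right x) \<bullet> h = h' \<bullet> x"
      by (rule riesz_representation) blast
    have transpose: "I \<phi> \<bullet> h = \<phi> h'" for \<phi>
      using h'[of "riesz \<phi>"] by (simp add: inner_commute[of h'] riesz_inner)
    have "dual_pair (K h') q = (\<integral>t. ?g t \<bullet> h \<partial>time_measure T)"
    proof (rule dual_pair_cong)
      show "AE t in time_measure T. \<rho>' (K h') t (\<rho> q t) = ?g t \<bullet> h"
        using k[of h'] by eventually_elim (simp add: transpose banach_adjoint_def bidual)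
    qed
    then show ?thesis by (simp add: transpose)
  qed
  show ?thesis
    unfolding weak_integral_def
  proof (rule the_equality)
    fix w assume "\<forall>h. w \<bullet> h = (\<integral>t. ?g t \<bullet> h \<partial>time_measure T)"
    then have "w \<bullet> h = ?w \<bullet> h" for h using weak by simp
    then show "w = ?w" using vector_eq_rdot by blast
  qed (simp add: weak)
qed

end

section \<open>The adjoint equation\<close>

text \<open>
  Continuous representatives agree on a closed set that contains almost every point of the open
  interval, hence on its closure.
\<close>

lemma has_trace_unique:
  assumes "0 < T" and s: "s \<in> {0..T}"
    and x: "has_trace T \<iota> u s x" and x': "has_trace T \<iota> u s x'"
  shows "x = x'"
proof -
  obtain c where c: "continuous_on {0..T} c" "AE t in time_measure T. c t = \<iota> (u t)" "c s = x"
    using x unfolding has_trace_def by blast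
  obtain c' where c': "continuous_on {0..T} c'" "AE t in time_measure T. c' t = \<iota> (u t)" "c' s = x'"
    using x' unfolding has_trace_def by blast
  define C where "C = {t \<in> {0..T}. dist (c t) (c' t) = 0}"
  have "closed C"
    unfolding C_def
    by (rule continuous_closed_preimage_constant) (auto intro: continuous_intros c c')
  have "AE t in time_measure T. c t = c' t"
    using c(2) c'(2) by eventually_elim simp
  then have "AE t \<in> {0<..<T} in lebesgue. t \<in> C"
    unfolding time_measure_def by (subst (asm) AE_restrict_space_iff) (auto simp: C_def elim: eventually_mono)
  then have "{0<..<T} \<subseteq> C"
    using mem_closed_if_AE_lebesgue_open[OF open_greaterThanLessThan \<open>closed C\<close>, of 0 T] by blast
  then have "closure {0<..<T} \<subseteq> C"
    using \<open>closed C\<close> by (rule closure_minimal)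
  then show ?thesis
    using s c(3) c'(3) \<open>0 < T\<close> by (auto simp: C_def)
qed

lemma time_trace_eq:
  assumes "0 < T" "s \<in> {0..T}" "has_trace T \<iota> u s x"
  shows "time_trace T \<iota> u s = x"
  unfolding time_trace_def
  using has_trace_unique[OF assms(1,2) _ assms(3)] assms(3) by (rule the_equality[rotated])

lemma has_trace_diff:
  assumes \<rho>: "L2_space T \<rho>" and x: "has_trace T \<iota> (\<rho> v) s x" and y: "has_trace T \<iota> (\<rho> w) s y"
  shows "has_trace T \<iota> (\<rho> (v - w)) s (x - y)"
proof -
  obtain c where c: "continuous_on {0..T} c" "AE t in time_measure T. c t = \<iota> (\<rho> v t)" "c s = x"
    using x unfolding has_trace_def by blast
  obtain d where d: "continuous_on {0..T} d" "AE t in time_measure T. d t = \<iota> (\<rho> w t)" "d s = y"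
    using y unfolding has_trace_def by blast
  have "AE t in time_measure T. c t - d t = \<iota> (\<rho> (v - w) t)"
    using c(2) d(2) L2_space_diff[OF \<rho>, of v w] by eventually_elim (simp add: blinfun.diff_right)
  then show ?thesis
    unfolding has_trace_def using c d by (intro exI[of _ "\<lambda>t. c t - d t"]) (auto intro: continuous_intros)
qed

locale evolution_spaces = L2_duality T \<rho> \<rho>'
  for T :: real
    and \<rho> :: "'l::{real_inner,complete_space} \<Rightarrow> real \<Rightarrow> 'u::{real_inner,complete_space}"
    and \<rho>' :: "'d::real_inner \<Rightarrow> real \<Rightarrow> 'u dual" +
  fixes \<iota> :: "'u \<Rightarrow>\<^sub>L 'h::real_inner"
    and J :: "'v::real_inner \<Rightarrow>\<^sub>L 'l" and D\<^sub>t :: "'v \<Rightarrow>\<^sub>L 'd"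
  assumes T: "0 < T" and W: "W_space T \<iota> \<rho> \<rho>' J D\<^sub>t"
begin

abbreviation solves_adjoint :: "('l \<Rightarrow>\<^sub>L 'd) \<Rightarrow> 'd \<Rightarrow> 'v \<Rightarrow> bool" where
  "solves_adjoint \<equiv> adjoint_solution T \<iota> \<rho> \<rho>' J D\<^sub>t"

abbreviation initial_value :: "'v \<Rightarrow> 'h" where
  "initial_value z \<equiv> time_trace T \<iota> (\<rho> (J z)) 0"

definition adjoint_stable :: "('l \<Rightarrow>\<^sub>L 'd) \<Rightarrow> real \<Rightarrow> bool" where
  "adjoint_stable B c \<longleftrightarrow>
     (\<forall>h z. solves_adjoint B h z \<longrightarrow> norm (J z) + norm (initial_value z) \<le> c * norm h)"

lemma adjoint_stableD:
  assumes "adjoint_stable B c" "solves_adjoint B h z"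
  shows "norm (J z) \<le> c * norm h" "norm (initial_value z) \<le> c * norm h"
proof -
  have "norm (J z) + norm (initial_value z) \<le> c * norm h"
    using assms unfolding adjoint_stable_def by blast
  then show "norm (J z) \<le> c * norm h" "norm (initial_value z) \<le> c * norm h"
    using norm_ge_zero[of "J z"] norm_ge_zero[of "initial_value z"] by linarith+
qed

lemma solves_adjoint_iff:
  "solves_adjoint B h z \<longleftrightarrow>
     (\<exists>b. (\<forall>w. dual_pair b w = dual_pair (B w) (J z)) \<and> - D\<^sub>t z + b = h) \<and>
     has_trace T \<iota> (\<rho> (J z)) T 0"
  by (simp add: adjoint_solution_def dual_pair_def)

lemma initial_value_diff:
  assumes "solves_adjoint B h z" "solves_adjoint B' h' z'"
  shows "initial_value (z - z') = initial_value z - initial_value z'"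
proof -
  have "\<exists>x. has_trace T \<iota> (\<rho> (J z)) 0 x" if "solves_adjoint B h z" for B h z
    using that unfolding adjoint_solution_def has_trace_def by blast
  then obtain x x' where x: "has_trace T \<iota> (\<rho> (J z)) 0 x" "has_trace T \<iota> (\<rho> (J z')) 0 x'"
    using assms by blast
  have "has_trace T \<iota> (\<rho> (J (z - z'))) 0 (x - x')"
    using has_trace_diff[OF \<rho> x] by (simp add: blinfun.diff_right)
  moreover have "0 \<in> {0..T}" using T by simp
  ultimately show ?thesis
    using x by (simp add: time_trace_eq[OF T])
qed

text \<open>
  The difference of solutions for two operators and the same right-hand side solves the adjoint
  equation for the second operator, with \<open>(B - B')\<^sup>\<star> z\<close> on the right.
\<close>

lemma solves_adjoint_diff:
  assumes z: "solves_adjoint B h z" and z': "solves_adjoint B' h z'"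
  obtains k where "solves_adjoint B' k (z' - z)" "norm k \<le> norm (B - B') * norm (J z)"
proof -
  obtain b where b: "\<And>w. dual_pair b w = dual_pair (B w) (J z)" "- D\<^sub>t z + b = h"
    using z unfolding solves_adjoint_iff by blast
  obtain b' where b': "\<And>w. dual_pair b' w = dual_pair (B' w) (J z')" "- D\<^sub>t z' + b' = h"
    using z' unfolding solves_adjoint_iff by blast
  obtain k where k: "\<And>w. dual_pair k w = dual_pair ((B - B') w) (J z)"
      "norm k \<le> norm (B - B') * norm (J z)"
    by (rule operator_adjoint) blast
  have "dual_pair (b' - b + k) w = dual_pair (B' w) (J (z' - z))" for w
    by (simp add: dual_pair.add_left dual_pair.diff_left dual_pair.diff_right b b' k
        blinfun.diff_left blinfun.diff_right)
  moreover have "- D\<^sub>t (z' - z) + (b' - b + k) = k"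
    using b(2) b'(2) by (simp add: blinfun.diff_right algebra_simps)
  moreover have "has_trace T \<iota> (\<rho> (J (z' - z))) T 0"
    using has_trace_diff[OF \<rho>, of \<iota> "J z'" T 0 "J z" 0] z z'
    by (simp add: solves_adjoint_iff blinfun.diff_right)
  ultimately have "solves_adjoint B' k (z' - z)"
    unfolding solves_adjoint_iff by blast
  with k(2) show thesis by (intro that)
qed

text \<open>
  The stability bound only controls the difference \<open>e\<close> of two solutions in \<open>'l\<close>. If \<open>J e = 0\<close>, the
  zero-order term of the equation vanishes and with it the time derivative, so \<open>e = 0\<close> in the graph
  norm.
\<close>

lemma solves_adjoint_unique:
  assumes stable: "adjoint_stable B c"
    and z: "solves_adjoint B h z" and z': "solves_adjoint B h z'"
  shows "z = z'"
proof -
  define e where "e = z' - z"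
  obtain k where k: "solves_adjoint B k e" "norm k \<le> norm (B - B) * norm (J z)"
    unfolding e_def by (rule solves_adjoint_diff[OF z z'])
  then have "k = 0" by simp
  then have J: "J e = 0"
    using adjoint_stableD(1)[OF stable k(1)] by simp
  obtain b where b: "\<And>w. dual_pair b w = dual_pair (B w) (J e)" "- D\<^sub>t e + b = k"
    using k(1) unfolding solves_adjoint_iff by blast
  have "norm b \<le> 0"
    by (rule norm_le_of_dual_pair_le) (simp_all add: b(1) J dual_pair.zero_right)
  then have "D\<^sub>t e = 0" using b(2) \<open>k = 0\<close> by simp
  moreover have "(norm e)\<^sup>2 = (norm (J e))\<^sup>2 + (norm (D\<^sub>t e))\<^sup>2"
    using W unfolding W_space_def by blast
  ultimately show ?thesis using J by (simp add: e_def)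
qed

text \<open>
  Stability makes the adjoint state unique, so the definite description in \<open>adjoint_formula\<close>
  denotes any given solution, and the formula becomes linear in the state.
\<close>

lemma adjoint_formula_eq:
  fixes A :: "'x::{real_inner,complete_space} \<Rightarrow>\<^sub>L 'h"
    and K :: "'x \<Rightarrow>\<^sub>L 'd" and k :: "real \<Rightarrow> 'x \<Rightarrow>\<^sub>L 'u dual"
    and D\<^sub>U :: "'u \<Rightarrow>\<^sub>L 'u dual"
  assumes stable: "adjoint_stable B c"
    and h: "AE t in time_measure T. \<rho>' h t = D\<^sub>U (\<rho> v t)" and z: "solves_adjoint B h z"
    and k: "\<And>e. AE t in time_measure T. \<rho>' (K e) t = k t e"
  shows "adjoint_formula T \<iota> \<rho> \<rho>' J D\<^sub>t A I\<^sub>X D\<^sub>U k B v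
    = I\<^sub>X (banach_adjoint A (blinfun_inner_right (initial_value z)) - parameter_adjoint K (J z))"
proof -
  have "(THE z. \<exists>h. (AE t in time_measure T. \<rho>' h t = D\<^sub>U (\<rho> v t)) \<and> solves_adjoint B h z) = z"
  proof (rule the_equality)
    show "\<exists>h. (AE t in time_measure T. \<rho>' h t = D\<^sub>U (\<rho> v t)) \<and> solves_adjoint B h z"
      using h z by blast
    fix z' assume "\<exists>h. (AE t in time_measure T. \<rho>' h t = D\<^sub>U (\<rho> v t)) \<and> solves_adjoint B h z'"
    then obtain h' where h': "AE t in time_measure T. \<rho>' h' t = D\<^sub>U (\<rho> v t)" "solves_adjoint B h' z'"
      by blast
    have "AE t in time_measure T. \<rho>' h' t = \<rho>' h t"
      using h h'(1) by eventually_elim simp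
    then have "h' = h" by (rule L2_space_eqI[OF \<rho>'])
    then show "z' = z" using solves_adjoint_unique[OF stable _ z] h'(2) by blast
  qed
  then show ?thesis
    unfolding adjoint_formula_def
    by (simp add: weak_integral_adjoint[OF k] blinfun.diff_right)
qed

text \<open>
  With \<open>z\<close>, \<open>z'\<close> the two adjoint states, the difference of the formulas is \<open>I\<^sub>X\<close> applied to
  \<open>A\<^sup>\<star> (z' - z)(0) - K'\<^sup>\<star> (z' - z) - (K' - K)\<^sup>\<star> z\<close>. The state \<open>z\<close> is bounded by \<open>c\<close> times the
  right-hand side; the difference \<open>z' - z\<close> solves an adjoint equation whose right-hand side is
  already of size \<open>\<delta> \<parallel>z\<parallel>\<close>, and stability is used on it once more.
\<close>

lemma adjoint_formula_perturbation:
  fixes A :: "'x::{real_inner,complete_space} \<Rightarrow>\<^sub>L 'h"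
    and K K' :: "'x \<Rightarrow>\<^sub>L 'd" and k k' :: "real \<Rightarrow> 'x \<Rightarrow>\<^sub>L 'u dual"
    and D\<^sub>U :: "'u \<Rightarrow>\<^sub>L 'u dual"
  assumes c: "0 \<le> c"
    and stable: "adjoint_stable B c" "adjoint_stable B' c"
    and solvable: "\<And>h. \<exists>z. solves_adjoint B h z" "\<And>h. \<exists>z. solves_adjoint B' h z"
    and k: "\<And>e. AE t in time_measure T. \<rho>' (K e) t = k t e"
    and k': "\<And>e. AE t in time_measure T. \<rho>' (K' e) t = k' t e"
    and close: "norm (B - B') \<le> \<delta>" "norm (K' - K) \<le> \<delta>"
  shows "norm (adjoint_formula T \<iota> \<rho> \<rho>' J D\<^sub>t A I\<^sub>X D\<^sub>U k' B' v
      - adjoint_formula T \<iota> \<rho> \<rho>' J D\<^sub>t A I\<^sub>X D\<^sub>U k B v)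
    \<le> c * norm I\<^sub>X * norm D\<^sub>U * (norm K' * c + 1 + norm A * c) * \<delta> * norm v"
proof -
  obtain h where h: "AE t in time_measure T. \<rho>' h t = D\<^sub>U (\<rho> v t)" "norm h \<le> norm D\<^sub>U * norm v"
    by (rule L2_space_compose[OF \<rho> \<rho>', of "norm D\<^sub>U" "blinfun_apply D\<^sub>U" v])
       (auto simp: norm_blinfun intro!: continuous_intros)
  obtain z where z: "solves_adjoint B h z" using solvable(1) by blast
  obtain z' where z': "solves_adjoint B' h z'" using solvable(2) by blast
  obtain e where e: "solves_adjoint B' e (z' - z)" "norm e \<le> norm (B - B') * norm (J z)"
    by (rule solves_adjoint_diff[OF z z'])
  have \<delta>: "0 \<le> \<delta>" using close(1) norm_ge_zero order_trans by blast
  have Jz: "norm (J z) \<le> c * norm h"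
    by (rule adjoint_stableD[OF stable(1) z])
  define q where "q = c * (\<delta> * (c * norm h))"
  have "norm e \<le> \<delta> * (c * norm h)"
    using e(2) mult_mono[OF close(1) Jz \<delta>] by simp
  then have "c * norm e \<le> q"
    unfolding q_def using c by (rule mult_left_mono)
  then have J: "norm (J (z' - z)) \<le> q" and i: "norm (initial_value (z' - z)) \<le> q"
    using adjoint_stableD[OF stable(2) e(1)] by linarith+
  let ?a = "banach_adjoint A (blinfun_inner_right (initial_value (z' - z)))"
  let ?p = "parameter_adjoint K' (J (z' - z))" and ?p' = "parameter_adjoint (K' - K) (J z)"
  have "(banach_adjoint A (blinfun_inner_right (initial_value z')) - parameter_adjoint K' (J z'))
      - (banach_adjoint A (blinfun_inner_right (initial_value z)) - parameter_adjoint K (J z))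
      = ?a - (parameter_adjoint K' (J z') - parameter_adjoint K (J z))"
    by (rule blinfun_eqI)
       (simp add: initial_value_diff[OF z' z] banach_adjoint_def blinfun.diff_left inner_diff_left)
  also have "\<dots> = ?a - (?p + ?p')"
    by (simp add: parameter_adjoint_diff blinfun.diff_right)
  finally have difference: "norm (adjoint_formula T \<iota> \<rho> \<rho>' J D\<^sub>t A I\<^sub>X D\<^sub>U k' B' v
      - adjoint_formula T \<iota> \<rho> \<rho>' J D\<^sub>t A I\<^sub>X D\<^sub>U k B v) = norm (I\<^sub>X (?a - (?p + ?p')))"
    by (simp only: adjoint_formula_eq[OF stable(1) h(1) z k] adjoint_formula_eq[OF stable(2) h(1) z' k']
        flip: blinfun.diff_right)
  have "norm (?a - (?p + ?p')) \<le> norm ?a + (norm ?p + norm ?p')"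
    by (intro order_trans[OF norm_triangle_ineq4] add_left_mono norm_triangle_ineq)
  also have "norm ?a \<le> q * norm A"
    unfolding banach_adjoint_def
    by (intro order_trans[OF norm_blinfun_compose] mult_right_mono)
       (simp_all add: norm_blinfun_inner_right i)
  also have "norm ?p \<le> norm K' * q"
    by (intro order_trans[OF norm_parameter_adjoint_le] mult_left_mono J) simp
  also have "norm ?p' \<le> \<delta> * (c * norm h)"
    by (intro order_trans[OF norm_parameter_adjoint_le] mult_mono close Jz \<delta>) simp
  also have "q * norm A + (norm K' * q + \<delta> * (c * norm h))
      = (c * (norm K' * c + 1 + norm A * c) * \<delta>) * norm h"
    by (simp add: q_def algebra_simps)
  also have "\<dots> \<le> (c * (norm K' * c + 1 + norm A * c) * \<delta>) * (norm D\<^sub>U * norm v)"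
    using c \<delta> h(2) by (intro mult_left_mono mult_nonneg_nonneg add_nonneg_nonneg) auto
  finally have "norm (?a - (?p + ?p')) \<le> (c * (norm K' * c + 1 + norm A * c) * \<delta>) * (norm D\<^sub>U * norm v)"
    by simp
  then have "norm I\<^sub>X * norm (?a - (?p + ?p'))
      \<le> norm I\<^sub>X * ((c * (norm K' * c + 1 + norm A * c) * \<delta>) * (norm D\<^sub>U * norm v))"
    by (rule mult_left_mono) simp
  with norm_blinfun[of I\<^sub>X "?a - (?p + ?p')"] show ?thesis
    unfolding difference by (simp add: mult_ac)
qed

end

section \<open>Convergence of the bi-level algorithms\<close>

theorem proposition4:
  fixes T R r :: real
    and \<iota> :: "'u::{real_inner,complete_space} \<Rightarrow>\<^sub>L 'h::{real_inner,complete_space}"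
    and \<rho> :: "'l::{real_inner,complete_space} \<Rightarrow> real \<Rightarrow> 'u"
    and \<rho>' :: "'d::{real_inner,complete_space} \<Rightarrow> real \<Rightarrow> 'u dual"
    and J :: "'v::{real_inner,complete_space} \<Rightarrow>\<^sub>L 'l"
    and D\<^sub>t :: "'v \<Rightarrow>\<^sub>L 'd"
    and A :: "'x::{real_inner,complete_space} \<Rightarrow>\<^sub>L 'h"
    and L :: "'l \<Rightarrow>\<^sub>L 'y::{real_inner,complete_space}"
    and f :: "real \<Rightarrow> 'x \<Rightarrow> 'u \<Rightarrow> 'u dual"
    and fN :: "'x \<Rightarrow> 'v \<Rightarrow> 'd"
    and f\<theta> :: "'x \<Rightarrow> 'v \<Rightarrow> 'x \<Rightarrow>\<^sub>L 'd"
    and f\<theta>_at :: "'x \<Rightarrow> 'v \<Rightarrow> real \<Rightarrow> 'x \<Rightarrow>\<^sub>L 'u dual"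
    and fu :: "'x \<Rightarrow> 'v \<Rightarrow> 'l \<Rightarrow>\<^sub>L 'd"
    and S :: "'x \<Rightarrow> 'v"
    and D\<^sub>U :: "'u \<Rightarrow>\<^sub>L 'u dual"
    and I\<^sub>X :: "'x dual \<Rightarrow>\<^sub>L 'x"
    and G :: "'x \<Rightarrow> 'y"
    and F :: "'x \<Rightarrow> 'v \<Rightarrow> 'd \<times> 'h"
    and Sadj :: "'x \<Rightarrow> 'v \<Rightarrow> 'l \<Rightarrow> 'x"
    and \<theta>\<^sub>e :: 'x and u\<^sub>e :: 'v and y :: 'y
    and BX :: "'x set" and BV :: "'v set"
    and MS' MS Cfu Lf Ccoe Mr \<mu>r MR \<mu>R KR \<alpha> :: real
    and LRr CfA MRt \<epsilon>bar \<sigma> \<nu> \<eta> Cpri Cpos :: real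
    and \<theta> :: "nat \<Rightarrow> 'x" and u :: "nat \<Rightarrow> nat \<Rightarrow> 'v" and \<kappa> :: "nat \<Rightarrow> nat"
    and \<epsilon> :: "nat \<Rightarrow> real"
  \<comment> \<open>function spaces and operators\<close>
  assumes T: "0 < T"
    and triple: "gelfand_triple \<iota>"
    and L2_U: "L2_space T \<rho>"
    and L2_Udual: "L2_space T \<rho>'"
    and W: "W_space T \<iota> \<rho> \<rho>' J D\<^sub>t"
    and D\<^sub>U: "bij (blinfun_apply D\<^sub>U)"
    and I\<^sub>X: "bij (blinfun_apply I\<^sub>X)"
    and cara: "caratheodory T f"
    and fN: "\<And>\<theta> u. AE t in time_measure T. \<rho>' (fN \<theta> u) t = f t \<theta> (\<rho> (J u) t)"
  \<comment> \<open>parameter-to-state map and exact data\<close>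
    and S_equation: "\<And>\<theta>. D\<^sub>t (S \<theta>) + fN \<theta> (S \<theta>) = 0"
    and S_initial: "\<And>\<theta>. has_trace T \<iota> (\<rho> (J (S \<theta>))) 0 (A \<theta>)"
    and S_diff: "\<And>\<theta>. S differentiable (at \<theta>)"
    and G: "G = (\<lambda>\<theta>. L (J (S \<theta>)))"
    and F: "F = residual_map T \<iota> \<rho> J D\<^sub>t A fN"
    and u\<^sub>e: "u\<^sub>e = S \<theta>\<^sub>e"
    and y: "y = G \<theta>\<^sub>e"
    and BX: "BX = ball \<theta>\<^sub>e R" and R: "0 < R"
    and BV: "BV = ball u\<^sub>e r" and r: "0 < r"
  \<comment> \<open>partial derivatives of f, and exact and approximate adjoints\<close>
    and f\<theta>: "\<And>\<theta> u. \<theta> \<in> BX \<Longrightarrow> u \<in> BV \<Longrightarrow> ((\<lambda>\<theta>. fN \<theta> u) has_derivative f\<theta> \<theta> u) (at \<theta>)"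
    and f\<theta>_at: "\<And>\<theta> u h. \<theta> \<in> BX \<Longrightarrow> u \<in> BV \<Longrightarrow>
          AE t in time_measure T. \<rho>' (f\<theta> \<theta> u h) t = f\<theta>_at \<theta> u t h"
    and fu: "\<And>\<theta> u. \<theta> \<in> BX \<Longrightarrow> u \<in> BV \<Longrightarrow>
          (fN \<theta> has_derivative (\<lambda>v. fu \<theta> u (J v))) (at u)"
    and Sadj: "Sadj = (\<lambda>\<theta> u. adjoint_formula T \<iota> \<rho> \<rho>' J D\<^sub>t A I\<^sub>X D\<^sub>U (f\<theta>_at \<theta> u) (fu \<theta> u))"
    and exact_adjoint: "\<And>\<theta> v. \<theta> \<in> BX \<Longrightarrow> S \<theta> \<in> BV \<Longrightarrow>
          adjoint (\<lambda>h. J (frechet_derivative S (at \<theta>) h)) v = Sadj \<theta> (S \<theta>) v"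
  \<comment> \<open>structural assumptions\<close>
    and pos: "0 < MS'" "0 < MS" "0 < Cfu" "0 < Lf" "0 < Ccoe" "0 < Mr" "0 < \<mu>r" "0 < MR" "0 < \<mu>R" "0 < KR"
    and less2: "Mr\<^sup>2 + \<mu>r < 2" "MR\<^sup>2 + \<mu>R < 2"
    and A1: "\<And>\<theta>. \<theta> \<in> BX \<Longrightarrow> onorm (frechet_derivative S (at \<theta>)) \<le> MS'"
            "\<And>\<theta>. \<theta> \<in> BX \<Longrightarrow> onorm (\<lambda>h. J (frechet_derivative S (at \<theta>) h)) \<le> MS"
            "\<And>\<theta>. \<theta> \<in> BX \<Longrightarrow> onorm (frechet_derivative G (at \<theta>)) \<le> MR"
    and A2_solvable: "\<And>\<theta> u h. \<theta> \<in> BX \<Longrightarrow> u \<in> BV \<Longrightarrow>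
          \<exists>z. adjoint_solution T \<iota> \<rho> \<rho>' J D\<^sub>t (fu \<theta> u) h z"
    and A2: "\<And>\<theta> u h z. \<theta> \<in> BX \<Longrightarrow> u \<in> BV \<Longrightarrow> adjoint_solution T \<iota> \<rho> \<rho>' J D\<^sub>t (fu \<theta> u) h z \<Longrightarrow>
          norm (J z) + norm (time_trace T \<iota> (\<rho> (J z)) 0) \<le> Cfu * norm h"
    and A3: "\<And>\<theta> \<theta>' u u'. \<theta> \<in> BX \<Longrightarrow> \<theta>' \<in> BX \<Longrightarrow> u \<in> BV \<Longrightarrow> u' \<in> BV \<Longrightarrow>
          norm (f\<theta> \<theta> u - f\<theta> \<theta>' u') + norm (fu \<theta> u - fu \<theta>' u')
            \<le> Lf * (norm (\<theta> - \<theta>') + norm (J (u - u')))"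
    and A4: "\<And>\<theta> u. \<theta> \<in> BX \<Longrightarrow> u \<in> BV \<Longrightarrow> onorm (frechet_derivative (F \<theta>) (at u)) \<le> Mr"
    and A5: "\<And>\<theta> u u'. \<theta> \<in> BX \<Longrightarrow> u \<in> BV \<Longrightarrow> u' \<in> BV \<Longrightarrow>
          2 * ((F \<theta> u - F \<theta> u') \<bullet> frechet_derivative (F \<theta>) (at u) (u - u'))
            \<ge> (Mr\<^sup>2 + \<mu>r) * (norm (F \<theta> u - F \<theta> u'))\<^sup>2"
    and A6: "1 \<le> \<alpha>"
            "\<And>\<theta> u. \<theta> \<in> BX \<Longrightarrow> u \<in> BV \<Longrightarrow>
          Ccoe * norm (F \<theta> u - F \<theta> (S \<theta>)) \<ge> norm (u - S \<theta>) powr \<alpha>"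
    and A7: "\<And>\<theta> \<theta>'. \<theta> \<in> BX \<Longrightarrow> \<theta>' \<in> BX \<Longrightarrow>
          2 * ((G \<theta> - G \<theta>') \<bullet> frechet_derivative G (at \<theta>) (\<theta> - \<theta>'))
            \<ge> (MR\<^sup>2 + \<mu>R) * (norm (G \<theta> - G \<theta>'))\<^sup>2"
            "\<And>\<theta> \<theta>'. \<theta> \<in> BX \<Longrightarrow> \<theta>' \<in> BX \<Longrightarrow>
          norm (frechet_derivative G (at \<theta>) (\<theta> - \<theta>')) \<le> KR * norm (G \<theta> - G \<theta>')"
  \<comment> \<open>the algorithm\<close>
    and algorithm: "bilevel_algorithm Sadj J L y F 0 S r \<theta> u \<kappa> \<or>
          sequential_bilevel_algorithm Sadj J L y F 0 S r \<theta> u \<kappa>"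
    and start: "\<theta> 0 \<in> BX"
    and states_in_ball: "\<And>j. \<theta> j \<in> BX \<Longrightarrow> S (\<theta> j) \<in> BV \<and> (\<forall>k\<le>\<kappa> j. u j k \<in> BV)"
    and \<epsilon>: "\<And>j. \<epsilon> j = norm (J (u j (\<kappa> j) - S (\<theta> j)))"
    and \<epsilon>bar: "\<And>j. \<epsilon> j \<le> \<epsilon>bar"
  \<comment> \<open>constants\<close>
    and LRr: "LRr = Lf * (R + r * norm J) + norm (f\<theta> \<theta>\<^sub>e u\<^sub>e) + norm (fu \<theta>\<^sub>e u\<^sub>e)"
    and CfA: "CfA = Lf * Cfu * norm I\<^sub>X * norm D\<^sub>U * (LRr * Cfu + 1 + norm A * Cfu)"
    and MRt: "MRt = (MS + CfA * \<epsilon>bar) * norm L"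
    and \<sigma>: "0 \<le> \<sigma>" "\<sigma> < \<mu>R"
    and \<nu>: "0 \<le> \<nu>" "\<nu> < \<sigma> / 2"
    and \<eta>: "0 < \<eta>" "(1 + \<eta>) * MRt\<^sup>2 < MR\<^sup>2 + \<mu>R / 2"
    and Cpri: "Cpri = (norm L)\<^sup>2 *
          (2 * (KR + CfA * R)\<^sup>2 / (\<mu>R - \<sigma>) + (1 + 1 / \<eta>) * MRt\<^sup>2 + 2 * CfA * R)"
    and Cpos: "Cpos = sqrt (Cpri / (\<sigma> / 2 - \<nu>))"
  \<comment> \<open>stopping rule\<close>
    and stopping: "\<And>j. Cpos * \<epsilon> j \<le> norm (G (\<theta> j) - y)"
  shows "(\<forall>j. \<theta> j \<in> BX) \<and>
         (\<exists>\<theta>bar. \<theta> \<longlonglongrightarrow> \<theta>bar \<and> (\<lambda>j. G (\<theta> j)) \<longlonglongrightarrow> y \<and> G \<theta>bar = y)"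
proof -
  interpret E: evolution_spaces T \<rho> \<rho>' \<iota> J D\<^sub>t
    by unfold_locales (fact L2_U L2_Udual T W)+
  have \<theta>\<^sub>e: "\<theta>\<^sub>e \<in> BX" and u\<^sub>e_BV: "u\<^sub>e \<in> BV"
    using R r by (simp_all add: BX BV)
  define S' where "S' x = frechet_derivative S (at x)" for x
  have S': "(S has_derivative S' x) (at x)" for x
    using S_diff[of x] unfolding S'_def by (simp add: frechet_derivative_works)
  have JS': "bounded_linear (\<lambda>h. J (S' x h))" for x
    using has_derivative_bounded_linear[OF S'] by (rule bounded_linear_blinfun_apply)
  have G_deriv: "(G has_derivative (\<lambda>h. L (J (S' x h)))) (at x)" for x
    unfolding G by (intro bounded_linear.has_derivative[OF blinfun.bounded_linear_right] S')
  have G': "frechet_derivative G (at x) = (\<lambda>h. L (J (S' x h)))" for x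
    using frechet_derivative_at[OF G_deriv] by simp

  define w where "w j = u j (\<kappa> j)" for j
  define v where "v j = L (J (w j)) - y" for j
  define q where "q j = adjoint (blinfun_apply L) (v j)" for j
  define \<delta> where "\<delta> j = norm L * \<epsilon> j" for j
  have step: "\<theta> j - \<theta> (Suc j) = Sadj (\<theta> j) (w j) (q j)" for j
    using algorithm
    unfolding bilevel_algorithm_def sequential_bilevel_algorithm_def upper_level_def
    by (auto simp: q_def v_def w_def)
  have \<epsilon>_nonneg: "0 \<le> \<epsilon> j" for j
    by (simp add: \<epsilon>)
  have norm_q: "norm (q j) \<le> norm L * norm (v j)" for j
    unfolding q_def norm_blinfun.rep_eq
    by (rule norm_adjoint_le) (rule blinfun.bounded_linear_right)

  have stable: "E.adjoint_stable (fu x z) Cfu" if "x \<in> BX" "z \<in> BV" for x z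
    unfolding E.adjoint_stable_def using A2[OF that] by blast
  have f\<theta>_le: "norm (f\<theta> x z) \<le> LRr" if x: "x \<in> BX" and z: "z \<in> BV" for x z
  proof -
    have "norm (J (z - u\<^sub>e)) \<le> norm J * norm (z - u\<^sub>e)"
      by (rule norm_blinfun)
    also have "\<dots> \<le> norm J * r"
      using z by (intro mult_left_mono) (auto simp: BV dist_norm norm_minus_commute)
    finally have "norm (x - \<theta>\<^sub>e) + norm (J (z - u\<^sub>e)) \<le> R + r * norm J"
      using x by (simp add: BX dist_norm norm_minus_commute mult.commute)
    then have "Lf * (norm (x - \<theta>\<^sub>e) + norm (J (z - u\<^sub>e))) \<le> Lf * (R + r * norm J)"
      using pos(4) by (intro mult_left_mono) auto
    moreover have "norm (f\<theta> x z - f\<theta> \<theta>\<^sub>e u\<^sub>e) \<le> Lf * (norm (x - \<theta>\<^sub>e) + norm (J (z - u\<^sub>e)))"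
      using A3[OF x \<theta>\<^sub>e z u\<^sub>e_BV] norm_ge_zero[of "fu x z - fu \<theta>\<^sub>e u\<^sub>e"] by linarith
    moreover have "norm (f\<theta> x z) \<le> norm (f\<theta> x z - f\<theta> \<theta>\<^sub>e u\<^sub>e) + norm (f\<theta> \<theta>\<^sub>e u\<^sub>e)"
      using norm_triangle_sub[of "f\<theta> x z" "f\<theta> \<theta>\<^sub>e u\<^sub>e"] by simp
    ultimately show ?thesis
      unfolding LRr using norm_ge_zero[of "fu \<theta>\<^sub>e u\<^sub>e"] by linarith
  qed
  have "0 \<le> LRr"
    using f\<theta>_le[OF \<theta>\<^sub>e u\<^sub>e_BV] norm_ge_zero order_trans by blast
  then have CfA_nonneg: "0 \<le> CfA"
    unfolding CfA using pos by (intro mult_nonneg_nonneg add_nonneg_nonneg) auto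

  \<comment> \<open>the lower-level error enters the adjoint only through the derivatives of \<open>f\<close>, which are
      Lipschitz continuous in the state\<close>
  have Sadj_error: "norm (Sadj (\<theta> j) (w j) p - Sadj (\<theta> j) (S (\<theta> j)) p) \<le> CfA * \<epsilon> j * norm p"
    if j: "\<theta> j \<in> BX" for j p
  proof -
    have w: "w j \<in> BV" and s: "S (\<theta> j) \<in> BV"
      using states_in_ball[OF j] by (auto simp: w_def)
    have "norm (f\<theta> (\<theta> j) (w j) - f\<theta> (\<theta> j) (S (\<theta> j)))
        + norm (fu (\<theta> j) (w j) - fu (\<theta> j) (S (\<theta> j))) \<le> Lf * \<epsilon> j"
      using A3[OF j j w s] by (simp add: \<epsilon> w_def)
    then have close: "norm (fu (\<theta> j) (S (\<theta> j)) - fu (\<theta> j) (w j)) \<le> Lf * \<epsilon> j"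
        "norm (f\<theta> (\<theta> j) (w j) - f\<theta> (\<theta> j) (S (\<theta> j))) \<le> Lf * \<epsilon> j"
      using norm_ge_zero[of "f\<theta> (\<theta> j) (w j) - f\<theta> (\<theta> j) (S (\<theta> j))"]
        norm_ge_zero[of "fu (\<theta> j) (w j) - fu (\<theta> j) (S (\<theta> j))"]
      unfolding norm_minus_commute[of "fu (\<theta> j) (S (\<theta> j))"] by linarith+
    have "norm (Sadj (\<theta> j) (w j) p - Sadj (\<theta> j) (S (\<theta> j)) p)
        \<le> Cfu * norm I\<^sub>X * norm D\<^sub>U * (norm (f\<theta> (\<theta> j) (w j)) * Cfu + 1 + norm A * Cfu)
          * (Lf * \<epsilon> j) * norm p"
      unfolding Sadj
      by (rule E.adjoint_formula_perturbation[OF _ stable[OF j s] stable[OF j w]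
            A2_solvable[OF j s] A2_solvable[OF j w] f\<theta>_at[OF j s] f\<theta>_at[OF j w] close])
         (use pos in simp)
    also have "\<dots> \<le> Cfu * norm I\<^sub>X * norm D\<^sub>U * (LRr * Cfu + 1 + norm A * Cfu) * (Lf * \<epsilon> j) * norm p"
      using pos \<epsilon>_nonneg f\<theta>_le[OF j w]
      by (intro mult_right_mono mult_left_mono add_right_mono mult_nonneg_nonneg) auto
    also have "\<dots> = CfA * \<epsilon> j * norm p"
      by (simp add: CfA mult_ac)
    finally show ?thesis .
  qed

  have exact: "Sadj (\<theta> j) (S (\<theta> j)) p = adjoint (\<lambda>h. J (S' (\<theta> j) h)) p" if "\<theta> j \<in> BX" for j p
    using exact_adjoint[OF that] states_in_ball[OF that] by (simp add: S'_def)

  interpret landweber: inexact_landweber G "\<lambda>x h. L (J (S' x h))" \<theta>\<^sub>e R "MR\<^sup>2" \<mu>R KR CfA MRt \<sigma> \<nu> \<eta> \<theta> v \<delta>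
  proof (rule inexact_landweber.intro)
    show "0 < KR" "0 \<le> CfA" "0 \<le> \<nu>" "\<nu> < \<sigma> / 2" "\<sigma> < \<mu>R" "0 < \<eta>"
        "(1 + \<eta>) * MRt\<^sup>2 < MR\<^sup>2 + \<mu>R / 2" "\<theta> 0 \<in> ball \<theta>\<^sub>e R"
      using pos CfA_nonneg \<nu> \<sigma> \<eta> start by (auto simp: BX)
    show "linear (\<lambda>h. L (J (S' x h)))" for x
      using has_derivative_bounded_linear[OF G_deriv] by (rule bounded_linear.linear)
    show "(MR\<^sup>2 + \<mu>R) * (norm (G x - G \<theta>\<^sub>e))\<^sup>2 \<le> 2 * ((G x - G \<theta>\<^sub>e) \<bullet> L (J (S' x (x - \<theta>\<^sub>e))))"
      if "x \<in> ball \<theta>\<^sub>e R" for x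
      using A7(1)[of x \<theta>\<^sub>e] that \<theta>\<^sub>e by (simp add: G' BX)
    show "norm (L (J (S' x (x - x')))) \<le> KR * norm (G x - G x')"
      if "x \<in> ball \<theta>\<^sub>e R" "x' \<in> ball \<theta>\<^sub>e R" for x x'
      using A7(2)[of x x'] that by (simp add: G' BX)
    fix j assume "\<theta> j \<in> ball \<theta>\<^sub>e R"
    then have j: "\<theta> j \<in> BX" by (simp add: BX)
    have "v j - (G (\<theta> j) - G \<theta>\<^sub>e) = L (J (w j - S (\<theta> j)))"
      by (simp add: v_def y G blinfun.diff_right)
    then show "norm (v j - (G (\<theta> j) - G \<theta>\<^sub>e)) \<le> \<delta> j"
      using norm_blinfun[of L "J (w j - S (\<theta> j))"] by (simp add: \<delta>_def \<epsilon> w_def)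
    have error: "norm (\<theta> j - \<theta> (Suc j) - Sadj (\<theta> j) (S (\<theta> j)) (q j)) \<le> CfA * \<delta> j * norm (v j)"
    proof -
      have "CfA * \<epsilon> j * norm (q j) \<le> CfA * \<epsilon> j * (norm L * norm (v j))"
        using CfA_nonneg \<epsilon>_nonneg norm_q by (intro mult_left_mono) auto
      with Sadj_error[OF j, of "q j"] show ?thesis
        unfolding step by (simp add: \<delta>_def mult_ac)
    qed
    have "norm (Sadj (\<theta> j) (S (\<theta> j)) (q j)) \<le> MS * norm (q j)"
      unfolding exact[OF j] using A1(2)[OF j]
      by (intro order_trans[OF norm_adjoint_le[OF JS']] mult_right_mono) (simp_all add: S'_def)
    also have "\<dots> \<le> MS * (norm L * norm (v j))"
      using norm_q pos by (intro mult_left_mono) auto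
    finally have "norm (\<theta> j - \<theta> (Suc j)) \<le> MS * (norm L * norm (v j)) + CfA * \<delta> j * norm (v j)"
      using error norm_triangle_sub[of "\<theta> j - \<theta> (Suc j)" "Sadj (\<theta> j) (S (\<theta> j)) (q j)"] by linarith
    also have "\<dots> = (MS + CfA * \<epsilon> j) * (norm L * norm (v j))"
      by (simp add: \<delta>_def algebra_simps)
    also have "\<dots> \<le> (MS + CfA * \<epsilon>bar) * (norm L * norm (v j))"
      using \<epsilon>bar[of j] CfA_nonneg by (intro mult_right_mono add_left_mono mult_left_mono) auto
    finally show "norm (\<theta> j - \<theta> (Suc j)) \<le> MRt * norm (v j)"
      by (simp add: MRt mult_ac)
    show "\<bar>(\<theta> j - \<theta> (Suc j)) \<bullet> h - v j \<bullet> L (J (S' (\<theta> j) h))\<bar> \<le> CfA * \<delta> j * norm (v j) * norm h" for h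
    proof -
      have "Sadj (\<theta> j) (S (\<theta> j)) (q j) \<bullet> h = J (S' (\<theta> j) h) \<bullet> q j"
        unfolding exact[OF j] by (subst inner_commute) (rule inner_adjoint[OF JS'])
      also have "\<dots> = v j \<bullet> L (J (S' (\<theta> j) h))"
        unfolding q_def by (subst inner_adjoint) (auto intro: blinfun.bounded_linear_right inner_commute)
      finally have "(\<theta> j - \<theta> (Suc j)) \<bullet> h - v j \<bullet> L (J (S' (\<theta> j) h))
          = (\<theta> j - \<theta> (Suc j) - Sadj (\<theta> j) (S (\<theta> j)) (q j)) \<bullet> h"
        by (simp add: inner_diff_left)
      also have "\<bar>\<dots>\<bar> \<le> norm (\<theta> j - \<theta> (Suc j) - Sadj (\<theta> j) (S (\<theta> j)) (q j)) * norm h"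
        by (rule Cauchy_Schwarz_ineq2)
      also have "\<dots> \<le> CfA * \<delta> j * norm (v j) * norm h"
        using error by (rule mult_right_mono) simp
      finally show ?thesis .
    qed
    \<comment> \<open>\<open>Cpri\<close> contains the factor \<open>\<parallel>L\<parallel>\<^sup>2\<close> that turns the state error into the data error \<open>\<delta>\<close>\<close>
    have "0 \<le> Cpri"
      unfolding Cpri using \<sigma> \<eta> CfA_nonneg R by (intro mult_nonneg_nonneg add_nonneg_nonneg) auto
    then have Cpos_sq: "(\<sigma> / 2 - \<nu>) * Cpos\<^sup>2 = Cpri" and "0 \<le> Cpos"
      using \<nu> by (simp_all add: Cpos)
    have "(Cpos * \<epsilon> j)\<^sup>2 \<le> (norm (G (\<theta> j) - y))\<^sup>2"
      using stopping \<open>0 \<le> Cpos\<close> \<epsilon>_nonneg by (intro power_mono) auto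
    then have "(\<sigma> / 2 - \<nu>) * (Cpos * \<epsilon> j)\<^sup>2 \<le> (\<sigma> / 2 - \<nu>) * (norm (G (\<theta> j) - y))\<^sup>2"
      using \<nu> by (intro mult_left_mono) auto
    also have "(\<sigma> / 2 - \<nu>) * (Cpos * \<epsilon> j)\<^sup>2 = Cpri * (\<epsilon> j)\<^sup>2"
      by (simp add: power_mult_distrib flip: Cpos_sq)
    finally show "(2 * (KR + CfA * R)\<^sup>2 / (\<mu>R - \<sigma>) + (1 + 1 / \<eta>) * MRt\<^sup>2 + 2 * CfA * R) * (\<delta> j)\<^sup>2
        \<le> (\<sigma> / 2 - \<nu>) * (norm (G (\<theta> j) - G \<theta>\<^sub>e))\<^sup>2"
      by (simp add: Cpri \<delta>_def y power_mult_distrib mult_ac)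
  qed

  have "continuous_on UNIV G"
    using G_deriv has_derivative_continuous continuous_at_imp_continuous_on by blast
  then obtain x where "\<theta> \<longlonglongrightarrow> x" "(\<lambda>j. G (\<theta> j)) \<longlonglongrightarrow> G \<theta>\<^sub>e" "G x = G \<theta>\<^sub>e"
    by (rule landweber.iterates_tendsto_solution)
  then show ?thesis
    using landweber.iterate_in_ball unfolding BX y by blast
qed

end
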